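(* Let $\mathbb X$ be a Euclidean space, $g\colon\mathbb X\to\mathbb R^m$ twice continuously differentiable, $D\subset\mathbb R^m$ closed and locally polyhedral around $g(\bar x)$, $\Phi(x):=g(x)-D$, $(\bar x,0)\in\operatorname{gph}\Phi$, $u\in\mathbb S_{\mathbb X}$. Assume that for each $s\in\mathbb X$ and all $y^*,z^*\in\mathbb R^m$: [$\nabla g(\bar x)^*y^*=0$, $\nabla^2\langle y^*,g\rangle(\bar x)(u)+\nabla g(\bar x)^*z^*=0$, $y^*\in\mathcal N_{\mathbf T(u)}(w_s(u,0))$, $z^*\in\mathcal N_{\mathbf T(u)}(w_s(u,0))$ (or, in the second variant, $z^*\in\mathcal T_{\mathcal N_{\mathbf T(u)}(w_s(u,0))}(y^* )$)] implies $y^*=0$. If for each $x^*,s\in\mathbb X$, $y^*,z^*\in\mathbb R^m$ and $\alpha\ge0$ with $v:=\alpha y^*$ satisfying $x^*=\nabla^2\langle y^*,g\rangle(\bar x)(u)+\nabla g(\bar x)^*z^*$, $y^*\in\mathcal N_{\mathbf T(u)}(w_s(u,v))\cap\ker\nabla g(\bar x)^*$, and $z^*\in\mathcal N_{\mathbf T(u)}(w_s(u,v))$ (or, in the second variant, $z^*\in\mathcal T_{\mathcal N_{\mathbf T(u)}(w_s(u,v))}(y^* )$), there is $\lambda\in\mathcal N_D(g(\bar x))$ with $x^*=\nabla g(\bar x)^*\lambda$, then $\Phi$ is asymptotically regular at $(\bar x,0)$ in direction $u$. Moreover, $\Phi$ is strongly asymptotically regular at $(\bar x,0)$ in direction $u$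 if such $\lambda$ can always be chosen from $\mathcal N_{\mathcal T_D(g(\bar x))}(\nabla g(\bar x)u)$. (Each of the two hypotheses may be imposed with either variant, independently.)
   Context: $\mathbf T(u):=\mathcal T_{\mathcal T_D(g(\bar x))}(\nabla g(\bar x)u)$, $w_s(u,v):=\nabla g(\bar x)s+\tfrac12\nabla^2g(\bar x)[u,u]-v$ with $\nabla^2g(\bar x)[u,u]=(\langle u,\nabla^2g_i(\bar x)u\rangle)_{i=1}^m$; $\nabla^2\langle y^*,g\rangle(\bar x)(u)$ is the Hessian of $x\mapsto\langle y^*,g(x)\rangle$ applied to $u$. $\mathcal T$, $\widehat{\mathcal N}$, $\mathcal N$: tangent, regular normal and limiting normal cones. Locally polyhedral: intersection with some box around $g(\bar x)$ is a finite union of convex polyhedra. Asymptotic regularity in direction $u$ at $(\bar x,0)$: for all $(x_k,y_k)\in\operatorname{gph}\Phi$, $x_k^*$, $\lambda_k$, $x^*$, $y^*$ with $x_k\notin\Phi^{-1}(0)$, $y_k\ne0$, $x_k^*\in\widehat D^*\Phi(x_k,y_k)(\lambda_k)$ and $x_k\to\bar x$, $y_k\to0$, $x_k^*\to x^*$, $\frac{x_k-\bar x}{\|x_k-\bar x\|}\to u$, $\frac{y_k}{\|x_k-\bar x\|}\to0$, $\frac{\|y_k\|}{\|x_k-\bar x\|}\lambda_k\to y^*$, $\|\lambda_k\|\to\infty$, $\frac{y_k}{\|y_k\|}-\frac{\lambda_k}{\|\lambda_k\|}\to0$, one has $x^*\in\operatorname{Im}D^*\Phi(\bar x,0)$; strong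 asymptotic regularity requires $x^*\in\operatorname{Im}D^*\Phi((\bar x,0);(u,0))$. Here $\widehat D^*\Phi(x,y)(y^* )=\{x^*\mid(x^*,-y^* )\in\widehat{\mathcal N}_{\operatorname{gph}\Phi}(x,y)\}$, $D^*$ with the limiting normal cone, $D^*\Phi((\bar x,0);(u,0))$ with the directional limiting normal cone to $\operatorname{gph}\Phi$ (all $\eta$ with $w_k\to(u,0)$, $t_k\downarrow0$, $\eta_k\to\eta$, $\eta_k\in\widehat{\mathcal N}_{\operatorname{gph}\Phi}((\bar x,0)+t_kw_k)$), $\operatorname{Im}\Psi=\bigcup\Psi(y^* )$. *)

theory Defs
  imports "HOL-Analysis.Analysis"
begin

definition tcone :: "'a::real_normed_vector set \<Rightarrow> 'a \<Rightarrow> 'a set" where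
  "tcone C x = {d. x \<in> C \<and> (\<exists>t dk. (\<forall>k. 0 < t k) \<and> t \<longlonglongrightarrow> 0 \<and> dk \<longlonglongrightarrow> d
                     \<and> (\<forall>k. x + t k *\<^sub>R dk k \<in> C))}"

definition reg_ncone :: "'a::real_inner set \<Rightarrow> 'a \<Rightarrow> 'a set" where
  "reg_ncone C x = {v. x \<in> C \<and> (\<forall>e>0. \<exists>\<delta>>0. \<forall>x'\<in>C. norm (x' - x) < \<delta> \<longrightarrow>
                     v \<bullet> (x' - x) \<le> e * norm (x' - x))}"

definition lim_ncone :: "'a::real_inner set \<Rightarrow> 'a \<Rightarrow> 'a set" where
  "lim_ncone C x = {v. x \<in> C \<and> (\<exists>xk vk. (\<forall>k. xk k \<in> C \<and> vk k \<in> reg_ncone C (xk k))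
                     \<and> xk \<longlonglongrightarrow> x \<and> vk \<longlonglongrightarrow> v)}"

definition dir_ncone :: "'a::real_inner set \<Rightarrow> 'a \<Rightarrow> 'a \<Rightarrow> 'a set" where
  "dir_ncone C x d = {v. \<exists>t w vk. (\<forall>k. 0 < t k \<and> vk k \<in> reg_ncone C (x + t k *\<^sub>R w k))
                     \<and> t \<longlonglongrightarrow> 0 \<and> w \<longlonglongrightarrow> d \<and> vk \<longlonglongrightarrow> v}"

definition phi_graph :: "('a \<Rightarrow> 'b::ab_group_add) \<Rightarrow> 'b set \<Rightarrow> ('a \<times> 'b) set" where
  "phi_graph g D = {(x, y). g x - y \<in> D}"

(* coderivatives of a set-valued map given by its graph G *)
definition reg_coderiv :: "('a::real_inner \<times> 'b::real_inner) set \<Rightarrow> 'a \<Rightarrow> 'b \<Rightarrow> 'b \<Rightarrow> 'a set" where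
  "reg_coderiv G x y ys = {xs. (xs, - ys) \<in> reg_ncone G (x, y)}"

definition lim_coderiv :: "('a::real_inner \<times> 'b::real_inner) set \<Rightarrow> 'a \<Rightarrow> 'b \<Rightarrow> 'b \<Rightarrow> 'a set" where
  "lim_coderiv G x y ys = {xs. (xs, - ys) \<in> lim_ncone G (x, y)}"

definition dir_coderiv :: "('a::real_inner \<times> 'b::real_inner) set \<Rightarrow> 'a \<Rightarrow> 'b \<Rightarrow> 'a \<Rightarrow> 'b \<Rightarrow> 'b \<Rightarrow> 'a set" where
  "dir_coderiv G x y u v ys = {xs. (xs, - ys) \<in> dir_ncone G (x, y) (u, v)}"

definition asym_reg_cond :: "('a::euclidean_space \<times> 'b::euclidean_space) set \<Rightarrow> 'a \<Rightarrow> 'a \<Rightarrow> 'a set \<Rightarrow> bool" where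
  "asym_reg_cond G xbar u Img \<longleftrightarrow>
    (\<forall>xk yk xsk lk xs ys.
       (\<forall>k. (xk k, yk k) \<in> G \<and> (xk k, 0) \<notin> G \<and> yk k \<noteq> 0 \<and> xsk k \<in> reg_coderiv G (xk k) (yk k) (lk k))
       \<and> xk \<longlonglongrightarrow> xbar \<and> yk \<longlonglongrightarrow> 0 \<and> xsk \<longlonglongrightarrow> xs
       \<and> (\<lambda>k. (1 / norm (xk k - xbar)) *\<^sub>R (xk k - xbar)) \<longlonglongrightarrow> u
       \<and> (\<lambda>k. (1 / norm (xk k - xbar)) *\<^sub>R yk k) \<longlonglongrightarrow> 0
       \<and> (\<lambda>k. (norm (yk k) / norm (xk k - xbar)) *\<^sub>R lk k) \<longlonglongrightarrow> ys
       \<and> filterlim (\<lambda>k. norm (lk k)) at_top sequentially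
       \<and> (\<lambda>k. (1 / norm (yk k)) *\<^sub>R yk k - (1 / norm (lk k)) *\<^sub>R lk k) \<longlonglongrightarrow> 0
     \<longrightarrow> xs \<in> Img)"

definition asym_regular :: "('a::euclidean_space \<times> 'b::euclidean_space) set \<Rightarrow> 'a \<Rightarrow> 'a \<Rightarrow> bool" where
  "asym_regular G xbar u \<longleftrightarrow> asym_reg_cond G xbar u (\<Union>ys. lim_coderiv G xbar 0 ys)"

definition strong_asym_regular :: "('a::euclidean_space \<times> 'b::euclidean_space) set \<Rightarrow> 'a \<Rightarrow> 'a \<Rightarrow> bool" where
  "strong_asym_regular G xbar u \<longleftrightarrow> asym_reg_cond G xbar u (\<Union>ys. dir_coderiv G xbar 0 u 0 ys)"

definition locally_polyhedral_at :: "'a::euclidean_space set \<Rightarrow> 'a \<Rightarrow> bool" where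
  "locally_polyhedral_at D y \<longleftrightarrow>
    (\<exists>a b. y \<in> box a b \<and> (\<exists>P. finite P \<and> (\<forall>p\<in>P. polyhedron p) \<and> D \<inter> cbox a b = \<Union>P))"

(* Hessian of x \<mapsto> <y, g x> at x applied to u, given the second derivative g2 of g at x:
   the vector H with <H, k> = <y, g''(x)[u,k]> for all k *)
definition lag_hess :: "('a::euclidean_space \<Rightarrow>\<^sub>L 'a \<Rightarrow>\<^sub>L 'b::real_inner) \<Rightarrow> 'b \<Rightarrow> 'a \<Rightarrow> 'a" where
  "lag_hess g2 y u = (\<Sum>b\<in>Basis. (y \<bullet> blinfun_apply (blinfun_apply g2 u) b) *\<^sub>R b)"

definition zcond :: "bool \<Rightarrow> 'a::real_inner set \<Rightarrow> 'a \<Rightarrow> 'a \<Rightarrow> 'a \<Rightarrow> bool" where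
  "zcond b T w y z \<longleftrightarrow> (if b then z \<in> lim_ncone T w else z \<in> tcone (lim_ncone T w) y)"

end

theory Submission
  imports Defs
begin

text \<open>Put \<open>K = T\<^sub>D(g xbar)\<close> and \<open>T = T\<^sub>K(g' xbar u)\<close>. Near the relevant points \<open>D\<close>, \<open>K\<close> and \<open>T\<close>
  are unions of cells of one central hyperplane arrangement, so the multipliers of an asymptotic
  sequence are regular normals to \<open>T\<close> at the second-order difference quotients, and the regular
  normal cone to \<open>T\<close> is a fixed polyhedral cone on each cell. With \<open>t\<^sub>k = \<parallel>x\<^sub>k - xbar\<parallel>\<close>, expanding
  \<open>x\<^sub>k\<^sup>* = g'(x\<^sub>k)\<^sup>* \<lambda>\<^sub>k\<close> to first order leaves three cases: \<open>t\<^sub>k \<lambda>\<^sub>k\<close> unbounded contradicts the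
  first hypothesis after normalisation; \<open>t\<^sub>k \<lambda>\<^sub>k \<rightarrow> 0\<close> yields a multiplier for \<open>x\<^sup>*\<close> directly; and
  \<open>t\<^sub>k \<lambda>\<^sub>k \<rightarrow> y \<noteq> 0\<close> produces data as in the second hypothesis. The vector \<open>z\<close> is found in a convex
  cone of normals containing \<open>y\<close>, so it satisfies both variants of the condition on \<open>z\<close>.\<close>

section \<open>Unions of cells of a central hyperplane arrangement\<close>

text \<open>The inequality defining regular normals is local and positively homogeneous in the
  displacement, so only the germ of the set matters, up to dilation. Every transfer of normals
  between \<open>D\<close>, its tangent cones and different points of one cell goes through
  this.\<close>

lemma reg_ncone_local_scale:
  fixes C C' :: "'a::real_inner set"
  assumes v: "v \<in> reg_ncone C p" and r: "0 < r" and t: "0 < t"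
    and loc: "\<And>d. norm d < r \<Longrightarrow> p + d \<in> C \<longleftrightarrow> q + t *\<^sub>R d \<in> C'"
  shows "v \<in> reg_ncone C' q"
  unfolding reg_ncone_def
proof (intro CollectI conjI allI impI)
  show "q \<in> C'" using v loc[of 0] r by (auto simp: reg_ncone_def)
  fix e :: real assume "e > 0"
  then obtain \<delta> where \<delta>: "\<delta> > 0"
    "\<And>x'. x' \<in> C \<Longrightarrow> norm (x' - p) < \<delta> \<Longrightarrow> v \<bullet> (x' - p) \<le> e * norm (x' - p)"
    using v unfolding reg_ncone_def by blast
  show "\<exists>\<delta>>0. \<forall>x'\<in>C'. norm (x' - q) < \<delta> \<longrightarrow> v \<bullet> (x' - q) \<le> e * norm (x' - q)"
  proof (intro exI[of _ "t * min r \<delta>"] conjI ballI impI)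
    show "0 < t * min r \<delta>" using r t \<delta>(1) by simp
    fix x' assume x': "x' \<in> C'" "norm (x' - q) < t * min r \<delta>"
    define d where "d = (1/t) *\<^sub>R (x' - q)"
    have xq: "x' - q = t *\<^sub>R d" using t by (simp add: d_def)
    have nd: "norm d < min r \<delta>" using x'(2) t unfolding xq by simp
    have "q + t *\<^sub>R d \<in> C'" using x'(1) xq by (metis add.commute diff_add_cancel)
    then have "p + d \<in> C" using loc nd by simp
    then have "v \<bullet> d \<le> e * norm d" using \<delta>(2)[of "p + d"] nd by simp
    then have "t * (v \<bullet> d) \<le> t * (e * norm d)" using t by (intro mult_left_mono) auto
    then show "v \<bullet> (x' - q) \<le> e * norm (x' - q)" unfolding xq using t by (simp add: algebra_simps)
  qed
qed

section \<open>Finitely generated cones and their linear images\<close>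

text \<open>One half of the Minkowski-Weyl theorem. The cone cut by the unit box is a polytope; its
  finitely many vertices generate the cone, because every element can be scaled into the
  box.\<close>

lemma finitely_constrained_cone_generated:
  fixes V :: "'a::euclidean_space set"
  assumes "finite V"
  obtains W where "finite W" "{x. \<forall>w\<in>V. w \<bullet> x \<le> 0} = convex_cone hull W"
proof -
  define C where "C = {x. \<forall>w\<in>V. w \<bullet> x \<le> 0}"
  have cc: "convex_cone C"
    unfolding convex_cone_iff C_def
    by (auto simp: inner_add_right inner_right_distrib mult_nonneg_nonpos intro: add_nonpos_nonpos)
  have "polyhedron C"
  proof -
    have "C = \<Inter>((\<lambda>w. {x. w \<bullet> x \<le> 0}) ` V)" by (auto simp: C_def)
    then show ?thesis using assms by (auto intro!: polyhedron_Inter polyhedron_halfspace_le)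
  qed
  then have "polytope (C \<inter> cbox (- One) One)"
    using polytope_Int_polyhedron[OF polytope_interval] by (metis Int_commute)
  then obtain W where W: "finite W" "C \<inter> cbox (- One) One = convex hull W"
    unfolding polytope_def by blast
  have "C = convex_cone hull W"
  proof
    have "W \<subseteq> C" using W(2) hull_subset by fastforce
    then show "convex_cone hull W \<subseteq> C" using cc by (simp add: hull_minimal)
    show "C \<subseteq> convex_cone hull W"
    proof
      fix x assume x: "x \<in> C"
      define c where "c = 1 / (norm x + 1)"
      have np: "norm x + 1 > 0" by (simp add: add_nonneg_pos)
      have c: "c > 0" using np by (simp add: c_def)
      have "c * norm x \<le> 1" using np by (simp add: c_def divide_simps)
      have "c *\<^sub>R x \<in> cbox (- One) One"
      proof -
        have "\<bar>c * (x \<bullet> i)\<bar> \<le> 1" if "i \<in> Basis" for i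
        proof -
          have "\<bar>x \<bullet> i\<bar> \<le> norm x" using that by (rule Basis_le_norm)
          then have "c * \<bar>x \<bullet> i\<bar> \<le> c * norm x" using c by (intro mult_left_mono) auto
          then have "c * \<bar>x \<bullet> i\<bar> \<le> 1" using \<open>c * norm x \<le> 1\<close> by (rule order_trans)
          then show ?thesis using c by (simp add: abs_mult)
        qed
        then show ?thesis by (fastforce simp: mem_box abs_le_iff)
      qed
      moreover have "c *\<^sub>R x \<in> C" using cc x c by (simp add: convex_cone_scaleR)
      ultimately have "c *\<^sub>R x \<in> convex_cone hull W"
        using W(2) convex_hull_subset_convex_cone_hull by blast
      then have "(1/c) *\<^sub>R (c *\<^sub>R x) \<in> convex_cone hull W"
        by (rule convex_cone_hull_mul) (use c in auto)
      moreover have "(1/c) *\<^sub>R (c *\<^sub>R x) = x" using c by simp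
      ultimately show "x \<in> convex_cone hull W" by metis
    qed
  qed
  with W(1) that show ?thesis unfolding C_def by blast
qed

text \<open>The image is generated by the images of finitely many generators, and finitely generated
  cones are closed. For general closed cones this fails, which is why polyhedrality is essential for
  the limit arguments.\<close>

lemma closed_linear_image_finitely_constrained_cone:
  fixes f :: "'a::euclidean_space \<Rightarrow> 'b::euclidean_space"
  assumes "finite V" "linear f"
  shows "closed (f ` {x. \<forall>w\<in>V. w \<bullet> x \<le> 0})"
proof -
  obtain W where W: "finite W" "{x. \<forall>w\<in>V. w \<bullet> x \<le> 0} = convex_cone hull W"
    using finitely_constrained_cone_generated[OF assms(1)] .
  show ?thesis
    unfolding W(2) convex_cone_hull_linear_image[OF assms(2), symmetric]
    using W(1) by (simp add: closed_convex_cone_hull)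
qed

section \<open>Arrangements of hyperplanes and tangent cones\<close>

text \<open>The classes of this equivalence relation are the cells (relatively open faces) of the
  central arrangement with normals \<open>F\<close>.\<close>

definition same_signs :: "'a::real_inner set \<Rightarrow> 'a \<Rightarrow> 'a \<Rightarrow> bool" where
  "same_signs F x y \<longleftrightarrow> (\<forall>a\<in>F. sgn (a \<bullet> x) = sgn (a \<bullet> y))"

text \<open>\<open>arr_near F C c r\<close>: inside the ball of radius \<open>r\<close> around \<open>c\<close>, the set \<open>C\<close> is a union of
  cells of the hyperplane arrangement through \<open>c\<close> with normals \<open>F\<close>; \<open>arr_cone F K\<close> is the global
  version at the origin.\<close>

definition arr_near :: "'a::real_inner set \<Rightarrow> 'a set \<Rightarrow> 'a \<Rightarrow> real \<Rightarrow> bool" where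
  "arr_near F C c r \<longleftrightarrow> finite F \<and> 0 < r \<and>
     (\<forall>d d'. norm d < r \<longrightarrow> norm d' < r \<longrightarrow> same_signs F d d' \<longrightarrow> (c + d \<in> C \<longleftrightarrow> c + d' \<in> C))"

definition arr_cone :: "'a::real_inner set \<Rightarrow> 'a set \<Rightarrow> bool" where
  "arr_cone F K \<longleftrightarrow> finite F \<and> closed K \<and> (\<forall>x y. same_signs F x y \<longrightarrow> (x \<in> K \<longleftrightarrow> y \<in> K))"

lemma same_signs_scaleR: "0 < t \<Longrightarrow> same_signs F (t *\<^sub>R x) x"
  by (simp add: same_signs_def sgn_mult)

lemma same_signs_sym: "same_signs F x y \<Longrightarrow> same_signs F y x"
  by (simp add: same_signs_def)

lemma arr_near_mono: "arr_near F C c r \<Longrightarrow> F \<subseteq> F' \<Longrightarrow> finite F' \<Longrightarrow> 0 < r' \<Longrightarrow> r' \<le> r \<Longrightarrow> arr_near F' C c r'"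
  by (simp add: arr_near_def same_signs_def subset_iff)

lemma arr_near_common:
  assumes "arr_near F C c r" "arr_near F' C' c r'"
  obtains G s where "arr_near G C c s" "arr_near G C' c s"
proof
  show "arr_near (F \<union> F') C c (min r r')"
    by (rule arr_near_mono[OF assms(1)]) (use assms in \<open>auto simp: arr_near_def\<close>)
  show "arr_near (F \<union> F') C' c (min r r')"
    by (rule arr_near_mono[OF assms(2)]) (use assms in \<open>auto simp: arr_near_def\<close>)
qed

lemma arr_near_Inter:
  assumes "finite H" "\<And>h. h \<in> H \<Longrightarrow> \<exists>F r. arr_near F h c r"
  shows "\<exists>F r. arr_near F (\<Inter>H) c r"
  using assms
proof (induction H rule: finite_induct)
  case empty
  have "arr_near {} UNIV c 1" by (simp add: arr_near_def)
  then show ?case by auto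
next
  case (insert h H)
  then obtain F r F' r' where "arr_near F h c r" "arr_near F' (\<Inter>H) c r'" by (meson insertCI)
  then obtain G s where "arr_near G h c s" "arr_near G (\<Inter>H) c s" by (rule arr_near_common)
  then have "arr_near G (h \<inter> \<Inter>H) c s" by (simp only: arr_near_def Int_iff) blast
  then show ?case by auto
qed

lemma arr_near_Union:
  assumes "finite H" "\<And>h. h \<in> H \<Longrightarrow> \<exists>F r. arr_near F h c r"
  shows "\<exists>F r. arr_near F (\<Union>H) c r"
  using assms
proof (induction H rule: finite_induct)
  case empty
  have "arr_near {} {} c 1" by (simp add: arr_near_def)
  then show ?case by auto
next
  case (insert h H)
  then obtain F r F' r' where "arr_near F h c r" "arr_near F' (\<Union>H) c r'" by (meson insertCI)
  then obtain G s where "arr_near G h c s" "arr_near G (\<Union>H) c s" by (rule arr_near_common)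
  then have "arr_near G (h \<union> \<Union>H) c s" by (simp only: arr_near_def Un_iff) blast
  then show ?case by auto
qed

text \<open>If \<open>c\<close> lies on the bounding hyperplane, the single normal \<open>a\<close>
  describes the halfspace near \<open>c\<close>; otherwise membership is constant near
  \<open>c\<close> and the empty arrangement suffices.\<close>

lemma arr_near_halfspace:
  fixes a c :: "'a::real_inner"
  shows "\<exists>F r. arr_near F {x. a \<bullet> x \<le> b} c r"
proof (cases "a \<bullet> c = b")
  case True
  have "arr_near {a} {x. a \<bullet> x \<le> b} c 1"
  proof -
    have "c + d \<in> {x. a \<bullet> x \<le> b} \<longleftrightarrow> sgn (a \<bullet> d) \<le> 0" for d
      using True by (simp add: inner_add_right)
    then show ?thesis by (simp add: arr_near_def same_signs_def del: sgn_le_0_iff)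
  qed
  then show ?thesis by blast
next
  case False
  define r where "r = \<bar>b - a \<bullet> c\<bar> / (norm a + 1)"
  have na: "norm a + 1 > 0" by (simp add: add_nonneg_pos)
  have r: "r > 0" using False na by (simp add: r_def)
  have "c + d \<in> {x. a \<bullet> x \<le> b} \<longleftrightarrow> a \<bullet> c \<le> b" if "norm d < r" for d
  proof -
    have "\<bar>a \<bullet> d\<bar> \<le> norm a * norm d" by (rule Cauchy_Schwarz_ineq2)
    also have "\<dots> \<le> (norm a + 1) * norm d" by (simp add: mult_right_mono)
    also have "\<dots> < (norm a + 1) * r" using that na by simp
    also have "\<dots> = \<bar>b - a \<bullet> c\<bar>" using na by (simp add: r_def)
    finally show ?thesis unfolding mem_Collect_eq inner_add_right by linarith
  qed
  then have "arr_near {} {x. a \<bullet> x \<le> b} c r" using r by (simp add: arr_near_def)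
  then show ?thesis by blast
qed

text \<open>Halfspaces have the local cell structure, and finite intersections and unions preserve
  it; shrinking the radius removes the box.\<close>

lemma locally_polyhedral_imp_arr_near:
  fixes D :: "'a::euclidean_space set"
  assumes "locally_polyhedral_at D c"
  obtains F r where "arr_near F D c r"
proof -
  obtain a b P where P: "c \<in> box a b" "finite P" "\<And>p. p \<in> P \<Longrightarrow> polyhedron p" "D \<inter> cbox a b = \<Union>P"
    using assms unfolding locally_polyhedral_at_def by blast
  have "\<exists>F r. arr_near F p c r" if "p \<in> P" for p
  proof -
    obtain H where H: "finite H" "p = \<Inter>H" "\<And>h. h \<in> H \<Longrightarrow> \<exists>a b. a \<noteq> 0 \<and> h = {x. a \<bullet> x \<le> b}"
      using P(3)[OF \<open>p \<in> P\<close>] unfolding polyhedron_def by blast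
    show ?thesis unfolding H(2)
      by (rule arr_near_Inter[OF H(1)]) (use H(3) arr_near_halfspace in blast)
  qed
  then obtain F r where F: "arr_near F (\<Union>P) c r" using arr_near_Union[OF P(2)] by blast
  obtain e where e: "e > 0" "ball c e \<subseteq> box a b" using P(1) open_box open_contains_ball by blast
  have "c + d \<in> D \<longleftrightarrow> c + d \<in> \<Union>P" if "norm d < e" for d
  proof -
    have "c + d \<in> cbox a b" using e(2) that box_subset_cbox by (force simp: dist_norm)
    then show ?thesis using P(4) by blast
  qed
  moreover have "arr_near F (\<Union>P) c (min r e)"
    by (rule arr_near_mono[OF F]) (use F e(1) in \<open>auto simp: arr_near_def\<close>)
  ultimately have "arr_near F D c (min r e)" unfolding arr_near_def by simp
  then show ?thesis by (rule that)
qed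

text \<open>Positive scaling keeps all signs, so inside the ball
  \<open>c + t k *\<^sub>R dk k\<close> and \<open>c + dk k\<close> are in \<open>C\<close>
  together. Near \<open>c\<close> the set thus coincides with its translated tangent cone,
  closedness of \<open>C\<close> handling the limit of \<open>dk\<close>.\<close>

lemma arr_near_mem_tcone_iff:
  assumes C: "closed C" "c \<in> C" and arr: "arr_near F C c r" and d: "norm d < r"
  shows "d \<in> tcone C c \<longleftrightarrow> c + d \<in> C"
proof
  assume "c + d \<in> C"
  define t :: "nat \<Rightarrow> real" where "t k = inverse (real (Suc k))" for k
  have t: "0 < t k" "t k \<le> 1" for k by (auto simp: t_def field_simps)
  have "c + t k *\<^sub>R d \<in> C" for k
  proof -
    have "t k * norm d \<le> norm d" using t[of k] by (simp add: mult_left_le_one_le)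
    then have "norm (t k *\<^sub>R d) < r" using d t[of k] by simp
    then show ?thesis
      using arr d \<open>c + d \<in> C\<close> same_signs_scaleR[OF t(1)] unfolding arr_near_def by blast
  qed
  moreover have "t \<longlonglongrightarrow> 0" unfolding t_def by (rule LIMSEQ_inverse_real_of_nat)
  ultimately show "d \<in> tcone C c" unfolding tcone_def using C(2) t(1)
    by (intro CollectI conjI exI[of _ t] exI[of _ "\<lambda>_. d"]) auto
next
  assume "d \<in> tcone C c"
  then obtain t dk where tk: "\<And>k. 0 < t k" "t \<longlonglongrightarrow> 0" "dk \<longlonglongrightarrow> d" "\<And>k. c + t k *\<^sub>R dk k \<in> C"
    unfolding tcone_def by blast
  have "(\<lambda>k. t k *\<^sub>R dk k) \<longlonglongrightarrow> 0 *\<^sub>R d" by (intro tendsto_intros tk)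
  then have "(\<lambda>k. norm (t k *\<^sub>R dk k)) \<longlonglongrightarrow> 0" using tendsto_norm_zero by fastforce
  then have "\<forall>\<^sub>F k in sequentially. norm (t k *\<^sub>R dk k) < r"
    using arr by (intro order_tendstoD(2)) (auto simp: arr_near_def)
  moreover have "\<forall>\<^sub>F k in sequentially. norm (dk k) < r"
    using d by (intro order_tendstoD(2)[OF tendsto_norm[OF tk(3)]])
  ultimately have "\<forall>\<^sub>F k in sequentially. c + dk k \<in> C"
  proof eventually_elim
    case (elim k)
    then show ?case using arr tk(4)[of k] same_signs_scaleR[OF tk(1)[of k]] unfolding arr_near_def by blast
  qed
  moreover have "(\<lambda>k. c + dk k) \<longlonglongrightarrow> c + d" by (intro tendsto_intros tk)
  ultimately show "c + d \<in> C" by (rule Lim_in_closed_set[OF C(1) _ trivial_limit_sequentially])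
qed

lemma tcone_scaleR:
  assumes "d \<in> tcone C c" "0 < s"
  shows "s *\<^sub>R d \<in> tcone C c"
proof -
  obtain t dk where tk: "\<And>k. 0 < t k" "t \<longlonglongrightarrow> 0" "dk \<longlonglongrightarrow> d" "\<And>k. c + t k *\<^sub>R dk k \<in> C"
    using assms(1) unfolding tcone_def by blast
  have "(\<lambda>k. t k / s) \<longlonglongrightarrow> 0" using tendsto_divide[OF tk(2) tendsto_const, of s] assms(2) by simp
  moreover have "(\<lambda>k. s *\<^sub>R dk k) \<longlonglongrightarrow> s *\<^sub>R d" by (intro tendsto_intros tk)
  ultimately show ?thesis using assms tk(1,4) unfolding tcone_def
    by (intro CollectI conjI exI[of _ "\<lambda>k. t k / s"] exI[of _ "\<lambda>k. s *\<^sub>R dk k"]) auto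
qed

lemma tcone_scaleR_iff: "0 < s \<Longrightarrow> s *\<^sub>R d \<in> tcone C c \<longleftrightarrow> d \<in> tcone C c"
  using tcone_scaleR[of d C c s] tcone_scaleR[of "s *\<^sub>R d" C c "1/s"] by auto

lemma small_scaling:
  fixes x y :: "'a::real_normed_vector"
  assumes "0 < r"
  obtains s where "0 < s" "norm (s *\<^sub>R x) < r" "norm (s *\<^sub>R y) < r"
proof
  define m where "m = norm x + norm y + 1"
  have m: "m > 0" "norm x < m" "norm y < m" by (auto simp: m_def add_nonneg_pos add_pos_nonneg add.commute
      intro: le_less_trans[OF norm_ge_zero])
  show "0 < r / m" using assms m by simp
  show "norm ((r / m) *\<^sub>R x) < r" "norm ((r / m) *\<^sub>R y) < r" using assms m by (auto simp: field_simps)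
qed

text \<open>The local description becomes global because a tangent cone is invariant under positive
  scaling: each question is moved into the ball of radius \<open>r\<close>.\<close>

lemma arr_cone_tcone:
  assumes C: "closed C" "c \<in> C" and arr: "arr_near F C c r"
  shows "arr_cone F (tcone C c)"
  unfolding arr_cone_def
proof (intro conjI allI impI)
  have r: "r > 0" using arr by (simp add: arr_near_def)
  show "finite F" using arr by (simp add: arr_near_def)
  show "closed (tcone C c)"
    unfolding closed_sequential_limits
  proof (intro allI impI, elim conjE)
    fix x l assume x: "\<forall>n. x n \<in> tcone C c" "x \<longlonglongrightarrow> l"
    obtain s where s: "0 < s" "norm (s *\<^sub>R l) < r" using small_scaling[OF r, of l l] by blast
    have lim: "(\<lambda>n. s *\<^sub>R x n) \<longlonglongrightarrow> s *\<^sub>R l" by (intro tendsto_intros x)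
    have "\<forall>\<^sub>F n in sequentially. norm (s *\<^sub>R x n) < r"
      by (rule order_tendstoD(2)[OF tendsto_norm[OF lim] s(2)])
    then have "\<forall>\<^sub>F n in sequentially. c + s *\<^sub>R x n \<in> C"
    proof eventually_elim
      case (elim n)
      then show ?case using arr_near_mem_tcone_iff[OF C arr elim] x(1) tcone_scaleR[OF _ s(1)] by blast
    qed
    moreover have "(\<lambda>n. c + s *\<^sub>R x n) \<longlonglongrightarrow> c + s *\<^sub>R l" by (intro tendsto_intros x)
    ultimately have "c + s *\<^sub>R l \<in> C" by (rule Lim_in_closed_set[OF C(1) _ trivial_limit_sequentially])
    then show "l \<in> tcone C c" using arr_near_mem_tcone_iff[OF C arr s(2)] tcone_scaleR_iff[OF s(1)] by blast
  qed
  fix x y assume xy: "same_signs F x y"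
  obtain s where s: "0 < s" "norm (s *\<^sub>R x) < r" "norm (s *\<^sub>R y) < r" using small_scaling[OF r] by blast
  have "same_signs F (s *\<^sub>R x) (s *\<^sub>R y)"
    using xy s(1) by (simp add: same_signs_def sgn_mult)
  then have "c + s *\<^sub>R x \<in> C \<longleftrightarrow> c + s *\<^sub>R y \<in> C" using arr s unfolding arr_near_def by blast
  then show "x \<in> tcone C c \<longleftrightarrow> y \<in> tcone C c"
    using arr_near_mem_tcone_iff[OF C arr s(2)] arr_near_mem_tcone_iff[OF C arr s(3)]
      tcone_scaleR_iff[OF s(1)] by blast
qed

section \<open>Regular normals to unions of cells\<close>

lemma sgn_inner_add_small:
  fixes F :: "'a::real_inner set"
  assumes "finite F"
  obtains r where "0 < r"
    "\<And>a d. a \<in> F \<Longrightarrow> norm d < r \<Longrightarrow>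
       sgn (a \<bullet> (q + d)) = (if a \<bullet> q = 0 then sgn (a \<bullet> d) else sgn (a \<bullet> q))"
  using assms
proof (induction F arbitrary: thesis rule: finite_induct)
  case empty
  show ?case by (rule empty[of 1]) auto
next
  case (insert a F)
  obtain r where r: "0 < r"
    "\<And>a d. a \<in> F \<Longrightarrow> norm d < r \<Longrightarrow>
       sgn (a \<bullet> (q + d)) = (if a \<bullet> q = 0 then sgn (a \<bullet> d) else sgn (a \<bullet> q))"
    using insert.IH by blast
  define e where "e = (if a \<bullet> q = 0 then 1 else \<bar>a \<bullet> q\<bar> / (norm a + 1))"
  have na: "norm a + 1 > 0" by (simp add: add_nonneg_pos)
  have e: "e > 0" using na by (simp add: e_def)
  have ae: "\<bar>a \<bullet> d\<bar> < \<bar>a \<bullet> q\<bar>" if "a \<bullet> q \<noteq> 0" "norm d < e" for d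
  proof -
    have "\<bar>a \<bullet> d\<bar> \<le> norm a * norm d" by (rule Cauchy_Schwarz_ineq2)
    also have "\<dots> \<le> (norm a + 1) * norm d" by (simp add: mult_right_mono)
    also have "\<dots> < (norm a + 1) * e" using that na by simp
    also have "\<dots> = \<bar>a \<bullet> q\<bar>" using na that by (simp add: e_def)
    finally show ?thesis .
  qed
  have a: "sgn (a \<bullet> (q + d)) = (if a \<bullet> q = 0 then sgn (a \<bullet> d) else sgn (a \<bullet> q))" if "norm d < e" for d
    using ae[of d] that by (cases "a \<bullet> q" "0::real" rule: linorder_cases) (auto simp: inner_add_right)
  show ?case
    by (rule insert.prems[of "min r e"]) (use r e a in auto)
qed

text \<open>Normals that do not vanish at \<open>q\<close> keep their sign nearby, and the others
  see only the displacement, so the same \<open>F\<close> works at every base point. This is what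
  allows taking a tangent cone a second time.\<close>

lemma arr_cone_imp_near:
  assumes "arr_cone F K"
  obtains r where "arr_near F K q r"
proof -
  obtain r where r: "0 < r"
    "\<And>a d. a \<in> F \<Longrightarrow> norm d < r \<Longrightarrow>
       sgn (a \<bullet> (q + d)) = (if a \<bullet> q = 0 then sgn (a \<bullet> d) else sgn (a \<bullet> q))"
    using sgn_inner_add_small[of F q] assms unfolding arr_cone_def by blast
  have "arr_near F K q r"
    unfolding arr_near_def
  proof (intro conjI allI impI)
    fix d d' assume "norm d < r" "norm d' < r" "same_signs F d d'"
    then have "same_signs F (q + d) (q + d')" using r(2) by (simp add: same_signs_def)
    then show "q + d \<in> K \<longleftrightarrow> q + d' \<in> K" using assms by (simp add: arr_cone_def)
  qed (use assms r in \<open>auto simp: arr_cone_def\<close>)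
  then show ?thesis by (rule that)
qed

text \<open>For small \<open>d\<close> the points \<open>q + d\<close> and \<open>q' + d\<close> lie
  in one cell, so \<open>K\<close> looks the same around \<open>q\<close> and
  \<open>q'\<close>.\<close>

lemma arr_cone_reg_ncone_subset:
  fixes K :: "'a::real_inner set"
  assumes K: "arr_cone F K" and qq: "same_signs F q q'"
  shows "reg_ncone K q \<subseteq> reg_ncone K q'"
proof
  fix v assume v: "v \<in> reg_ncone K q"
  have F: "finite F" using K by (simp add: arr_cone_def)
  obtain r where r: "0 < r"
    "\<And>a d. a \<in> F \<Longrightarrow> norm d < r \<Longrightarrow>
       sgn (a \<bullet> (q + d)) = (if a \<bullet> q = 0 then sgn (a \<bullet> d) else sgn (a \<bullet> q))"
    using sgn_inner_add_small[OF F, of q] by blast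
  obtain r' where r': "0 < r'"
    "\<And>a d. a \<in> F \<Longrightarrow> norm d < r' \<Longrightarrow>
       sgn (a \<bullet> (q' + d)) = (if a \<bullet> q' = 0 then sgn (a \<bullet> d) else sgn (a \<bullet> q'))"
    using sgn_inner_add_small[OF F, of q'] by blast
  have z: "a \<bullet> q = 0 \<longleftrightarrow> a \<bullet> q' = 0" if "a \<in> F" for a
    using qq that by (metis same_signs_def sgn_zero_iff)
  show "v \<in> reg_ncone K q'"
  proof (rule reg_ncone_local_scale[OF v, of "min r r'" 1])
    fix d :: 'a assume "norm d < min r r'"
    then have "same_signs F (q + d) (q' + d)"
      using r(2) r'(2) z qq by (simp add: same_signs_def)
    then show "q + d \<in> K \<longleftrightarrow> q' + 1 *\<^sub>R d \<in> K" using K by (simp add: arr_cone_def)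
  qed (use r r' in auto)
qed

lemma arr_cone_reg_ncone_scaleR:
  assumes "arr_cone F K" "0 < t"
  shows "reg_ncone K (t *\<^sub>R q) = reg_ncone K q"
  using arr_cone_reg_ncone_subset[OF assms(1)] same_signs_scaleR[OF assms(2)] same_signs_sym by blast

lemma arr_near_reg_ncone_tcone:
  assumes C: "closed C" "c \<in> C" and arr: "arr_near F C c r" and d: "norm d < r"
  shows "reg_ncone (tcone C c) d = reg_ncone C (c + d)"
proof -
  have pos: "0 < r - norm d" using d by simp
  have eq: "d + h \<in> tcone C c \<longleftrightarrow> (c + d) + h \<in> C" if "norm h < r - norm d" for h
  proof -
    have "norm (d + h) < r" using that norm_triangle_ineq[of d h] by simp
    then show ?thesis using arr_near_mem_tcone_iff[OF C arr] by (simp add: add.assoc)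
  qed
  show ?thesis
  proof (intro equalityI subsetI)
    fix v assume "v \<in> reg_ncone (tcone C c) d"
    then show "v \<in> reg_ncone C (c + d)"
      by (rule reg_ncone_local_scale[OF _ pos, of _ _ _ 1]) (use eq in auto)
  next
    fix v assume "v \<in> reg_ncone C (c + d)"
    then show "v \<in> reg_ncone (tcone C c) d"
      by (rule reg_ncone_local_scale[OF _ pos, of _ _ _ 1]) (use eq in auto)
  qed
qed

text \<open>Regular normals are constant along open rays, so the points witnessing a limiting normal
  at \<open>d\<close> can be shrunk towards the apex, where the tangent cone and \<open>C\<close>
  coincide.\<close>

lemma lim_ncone_tcone_subset:
  assumes C: "closed C" "c \<in> C" and arr: "arr_near F C c r"
  shows "lim_ncone (tcone C c) d \<subseteq> lim_ncone C c"
proof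
  fix v assume "v \<in> lim_ncone (tcone C c) d"
  then obtain dk vk where k: "\<And>k. vk k \<in> reg_ncone (tcone C c) (dk k)" "dk \<longlonglongrightarrow> d" "vk \<longlonglongrightarrow> v"
    unfolding lim_ncone_def by blast
  have r: "0 < r" using arr by (simp add: arr_near_def)
  note K = arr_cone_tcone[OF C arr]
  \<comment> \<open>The first factor brings \<open>dk k\<close> into the ball of radius
    \<open>r\<close>, the second drives the points to the apex.\<close>
  define s where "s k = (r / (norm (dk k) + 1)) * inverse (real (Suc k))" for k
  have n: "norm (dk k) + 1 > 0" for k by (simp add: add_nonneg_pos)
  have s: "0 < s k" for k using r n by (simp add: s_def)
  have sd: "norm (s k *\<^sub>R dk k) < r * inverse (real (Suc k))" for k
  proof -
    have "norm (dk k) / (norm (dk k) + 1) < 1" using n[of k] by simp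
    then have "(r * inverse (real (Suc k))) * (norm (dk k) / (norm (dk k) + 1)) < (r * inverse (real (Suc k))) * 1"
      using r by (intro mult_strict_left_mono) auto
    then have "s k * norm (dk k) < r * inverse (real (Suc k))" by (simp add: s_def mult.commute)
    then show ?thesis using s[of k] by simp
  qed
  have le: "r * inverse (real (Suc k)) \<le> r" for k using r by (simp add: field_simps)
  have "vk k \<in> reg_ncone C (c + s k *\<^sub>R dk k)" for k
  proof -
    have "vk k \<in> reg_ncone (tcone C c) (s k *\<^sub>R dk k)"
      using k(1) arr_cone_reg_ncone_scaleR[OF K s] by blast
    then show ?thesis using arr_near_reg_ncone_tcone[OF C arr] sd[of k] le[of k] by force
  qed
  moreover have "(\<lambda>k. s k *\<^sub>R dk k) \<longlonglongrightarrow> 0"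
  proof (rule Lim_null_comparison)
    show "\<forall>\<^sub>F k in sequentially. norm (s k *\<^sub>R dk k) \<le> r * inverse (real (Suc k))"
      using sd by (intro always_eventually) (auto intro: less_imp_le)
    show "(\<lambda>k. r * inverse (real (Suc k))) \<longlonglongrightarrow> 0"
      using tendsto_mult[OF tendsto_const LIMSEQ_inverse_real_of_nat, of r] by simp
  qed
  then have "(\<lambda>k. c + s k *\<^sub>R dk k) \<longlonglongrightarrow> c" using tendsto_add[OF tendsto_const, of _ 0 _ c] by fastforce
  ultimately show "v \<in> lim_ncone C c" using C(2) k(3) unfolding lim_ncone_def
    by (intro CollectI conjI exI[of _ "\<lambda>k. c + s k *\<^sub>R dk k"] exI[of _ vk]) (auto simp: reg_ncone_def)
qed

section \<open>Closures of cells and polyhedral normal cones\<close>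

text \<open>The closure of the cell of \<open>x\<close>: strict signs are relaxed to weak ones, and
  where \<open>a\<close> vanishes at \<open>x\<close> both inequalities force it to vanish at
  \<open>y\<close>.\<close>

definition closed_cell :: "'a::real_inner set \<Rightarrow> 'a \<Rightarrow> 'a set" where
  "closed_cell F x = {y. \<forall>a\<in>F. (a \<bullet> x \<le> 0 \<longrightarrow> a \<bullet> y \<le> 0) \<and> (0 \<le> a \<bullet> x \<longrightarrow> 0 \<le> a \<bullet> y)}"

lemma closed_cell_finitely_constrained:
  assumes "finite F"
  obtains V where "finite V" "closed_cell F x = {y. \<forall>w\<in>V. w \<bullet> y \<le> 0}"
proof
  let ?V = "{a \<in> F. a \<bullet> x \<le> 0} \<union> uminus ` {a \<in> F. 0 \<le> a \<bullet> x}"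
  show "finite ?V" using assms by simp
  show "closed_cell F x = {y. \<forall>w\<in>?V. w \<bullet> y \<le> 0}"
    unfolding closed_cell_def ball_Un ball_simps by auto
qed

lemma self_in_closed_cell: "x \<in> closed_cell F x"
  by (auto simp: closed_cell_def)

lemma same_signs_imp_closed_cell_eq:
  assumes "same_signs F x y"
  shows "closed_cell F x = closed_cell F y"
proof -
  have "a \<bullet> x \<le> 0 \<longleftrightarrow> a \<bullet> y \<le> 0" "0 \<le> a \<bullet> x \<longleftrightarrow> 0 \<le> a \<bullet> y" if "a \<in> F" for a
    using assms that unfolding same_signs_def by (metis sgn_le_0_iff, metis zero_le_sgn_iff)
  then show ?thesis by (simp add: closed_cell_def)
qed

lemma closed_cell_add_same_signs:
  assumes y: "y \<in> closed_cell F x" and e: "0 < e"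
  shows "same_signs F (y + e *\<^sub>R x) x"
  unfolding same_signs_def
proof
  fix a assume a: "a \<in> F"
  have "a \<bullet> x \<le> 0 \<Longrightarrow> a \<bullet> y \<le> 0" "0 \<le> a \<bullet> x \<Longrightarrow> 0 \<le> a \<bullet> y"
    using y a by (auto simp: closed_cell_def)
  then show "sgn (a \<bullet> (y + e *\<^sub>R x)) = sgn (a \<bullet> x)"
    using e mult_pos_pos[of e "a \<bullet> x"] mult_pos_neg[of e "a \<bullet> x"]
    by (cases "a \<bullet> x" "0::real" rule: linorder_cases) (auto simp: inner_add_right add_nonneg_pos add_nonpos_neg)
qed

lemma finite_sign_classes:
  assumes "finite F"
  shows "finite (range (\<lambda>x. restrict (\<lambda>a. sgn (a \<bullet> x)) F))"
proof (rule finite_subset)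
  show "range (\<lambda>x. restrict (\<lambda>a. sgn (a \<bullet> x)) F) \<subseteq> F \<rightarrow>\<^sub>E {-1, 0, 1}"
    by (auto simp: sgn_real_def split: if_splits)
  show "finite (F \<rightarrow>\<^sub>E {-1, 0, 1::real})" using assms by (simp add: finite_PiE)
qed

lemma same_signs_iff_restrict_eq:
  "same_signs F x y \<longleftrightarrow> restrict (\<lambda>a. sgn (a \<bullet> x)) F = restrict (\<lambda>a. sgn (a \<bullet> y)) F"
  by (auto simp: same_signs_def restrict_def fun_eq_iff)

lemma finite_closed_cells:
  assumes "finite F"
  shows "finite (range (closed_cell F))"
proof -
  let ?sg = "\<lambda>x. restrict (\<lambda>a. sgn (a \<bullet> x)) F"
  \<comment> \<open>A closed cell depends only on the sign vector, so \<open>?h\<close> recovers it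
    from an arbitrary representative of that vector.\<close>
  let ?h = "\<lambda>s. closed_cell F (SOME x. ?sg x = s)"
  show ?thesis
  proof (rule finite_subset)
    show "finite (?h ` range ?sg)" using finite_sign_classes[OF assms] by blast
    show "range (closed_cell F) \<subseteq> ?h ` range ?sg"
    proof clarify
      fix x
      have "?sg (SOME x'. ?sg x' = ?sg x) = ?sg x"
        by (rule someI[where P="\<lambda>x'. ?sg x' = ?sg x"]) simp
      then have "closed_cell F x = ?h (?sg x)"
        by (intro same_signs_imp_closed_cell_eq) (simp add: same_signs_iff_restrict_eq)
      then show "closed_cell F x \<in> ?h ` range ?sg" by blast
    qed
  qed
qed

lemma closed_cell_subset_arr_cone:
  assumes K: "arr_cone F K" and x: "x \<in> K"
  shows "closed_cell F x \<subseteq> K"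
proof
  fix y assume y: "y \<in> closed_cell F x"
  have "y + inverse (real (Suc n)) *\<^sub>R x \<in> K" for n
    using closed_cell_add_same_signs[OF y, of "inverse (real (Suc n))"] K x by (auto simp: arr_cone_def)
  moreover have "(\<lambda>n. y + inverse (real (Suc n)) *\<^sub>R x) \<longlonglongrightarrow> y + 0 *\<^sub>R x"
    by (intro tendsto_intros LIMSEQ_inverse_real_of_nat)
  ultimately show "y \<in> K" using K closed_sequentially[of K "\<lambda>n. y + inverse (real (Suc n)) *\<^sub>R x"]
    by (auto simp: arr_cone_def)
qed

text \<open>\<open>K\<close> is a finite union of closed cells, each finitely generated;
  nonpositivity on \<open>K\<close> need only be tested on all these generators.\<close>

lemma arr_cone_polar_finitely_constrained:
  fixes K :: "'a::euclidean_space set"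
  assumes K: "arr_cone F K"
  obtains V where "finite V" "{v. \<forall>d\<in>K. v \<bullet> d \<le> 0} = {v. \<forall>w\<in>V. w \<bullet> v \<le> 0}"
proof -
  have F: "finite F" using K by (simp add: arr_cone_def)
  have "\<exists>W. finite W \<and> closed_cell F x = convex_cone hull W" for x
  proof -
    obtain V where V: "finite V" "closed_cell F x = {y. \<forall>w\<in>V. w \<bullet> y \<le> 0}"
      using closed_cell_finitely_constrained[OF F] .
    show ?thesis unfolding V(2) by (rule finitely_constrained_cone_generated[OF V(1)]) blast
  qed
  \<comment> \<open>Generators are chosen per closed cell rather than per point, which keeps their
    union \<open>V\<close> finite.\<close>
  then have "\<forall>S \<in> closed_cell F ` K. \<exists>W. finite W \<and> convex_cone hull W = S"
    by blast
  then obtain gen where gen: "\<forall>S \<in> closed_cell F ` K. finite (gen S) \<and> convex_cone hull (gen S) = S"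
    by (rule bchoice[THEN exE])
  define V where "V = \<Union>(gen ` closed_cell F ` K)"
  have "finite (closed_cell F ` K)" using finite_closed_cells[OF F] by (rule rev_finite_subset) auto
  then have fin: "finite V" unfolding V_def by (rule finite_UN_I) (use gen in blast)
  have "V \<subseteq> K"
  proof
    fix w assume "w \<in> V"
    then obtain x where x: "x \<in> K" "w \<in> gen (closed_cell F x)" by (auto simp: V_def)
    then have "w \<in> closed_cell F x" using gen hull_subset[of "gen (closed_cell F x)" convex_cone] by auto
    then show "w \<in> K" using closed_cell_subset_arr_cone[OF K x(1)] by blast
  qed
  moreover have "v \<bullet> d \<le> 0" if v: "\<forall>w\<in>V. w \<bullet> v \<le> 0" and d: "d \<in> K" for v d
  proof -
    have "gen (closed_cell F d) \<subseteq> {x. v \<bullet> x \<le> 0}" using v d by (auto simp: V_def inner_commute)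
    then have "convex_cone hull (gen (closed_cell F d)) \<subseteq> {x. v \<bullet> x \<le> 0}"
      by (rule hull_minimal) (rule convex_cone_halfspace_le)
    then show ?thesis using gen self_in_closed_cell[of d F] d by auto
  qed
  ultimately have "{v. \<forall>d\<in>K. v \<bullet> d \<le> 0} = {v. \<forall>w\<in>V. w \<bullet> v \<le> 0}" by (auto simp: inner_commute)
  with fin that show ?thesis by blast
qed

text \<open>At the apex the regular normal cone is the polar: every direction of \<open>K\<close>
  can be made arbitrarily short, so the error \<open>e * norm d\<close> is beaten by
  homogeneity.\<close>

lemma arr_cone_reg_ncone_0:
  assumes K: "arr_cone F K" and "0 \<in> K"
  shows "reg_ncone K 0 = {v. \<forall>d\<in>K. v \<bullet> d \<le> 0}"
proof (intro equalityI subsetI CollectI ballI)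
  fix v assume v: "v \<in> {v. \<forall>d\<in>K. v \<bullet> d \<le> 0}"
  have "v \<bullet> d \<le> e * norm d" if "d \<in> K" "0 < e" for d e
    by (rule order_trans[of _ 0]) (use v that in auto)
  then show "v \<in> reg_ncone K 0" using assms(2) zero_less_one unfolding reg_ncone_def diff_0_right by blast
next
  fix v d assume v: "v \<in> reg_ncone K 0" and d: "d \<in> K"
  show "v \<bullet> d \<le> 0"
  proof (rule ccontr)
    assume "\<not> v \<bullet> d \<le> 0"
    then have vd: "v \<bullet> d > 0" by simp
    then have nd: "norm d > 0" by auto
    define e where "e = (v \<bullet> d) / (2 * norm d)"
    have "e > 0" using vd nd by (simp add: e_def)
    then obtain \<delta> where \<delta>: "\<delta> > 0" "\<And>x'. x' \<in> K \<Longrightarrow> norm x' < \<delta> \<Longrightarrow> v \<bullet> x' \<le> e * norm x'"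
      using v unfolding reg_ncone_def diff_0_right by blast
    obtain s where s: "0 < s" "norm (s *\<^sub>R d) < \<delta>" using small_scaling[OF \<delta>(1), of d d] by blast
    have "s *\<^sub>R d \<in> K" using K d same_signs_scaleR[OF s(1)] unfolding arr_cone_def by blast
    then have "v \<bullet> (s *\<^sub>R d) \<le> e * norm (s *\<^sub>R d)" using \<delta>(2) s(2) by blast
    then have "s * (v \<bullet> d) \<le> s * (v \<bullet> d) / 2" using s(1) nd by (simp add: e_def)
    then show False using s(1) vd by (simp add: mult_le_0_iff)
  qed
qed

text \<open>Regular normals at \<open>q\<close> are those at the apex of the tangent cone at
  \<open>q\<close>, hence form the polar of a finite union of polyhedral cones.\<close>

lemma arr_cone_reg_ncone_finitely_constrained:
  fixes K :: "'a::euclidean_space set"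
  assumes K: "arr_cone F K" and q: "q \<in> K"
  obtains V where "finite V" "reg_ncone K q = {v. \<forall>w\<in>V. w \<bullet> v \<le> 0}"
proof -
  obtain r where near: "arr_near F K q r" using arr_cone_imp_near[OF K] .
  have cl: "closed K" using K by (simp add: arr_cone_def)
  have r: "0 < r" using near by (simp add: arr_near_def)
  have T: "arr_cone F (tcone K q)" by (rule arr_cone_tcone[OF cl q near])
  have "0 \<in> tcone K q" using arr_near_mem_tcone_iff[OF cl q near, of 0] r q by simp
  moreover have "reg_ncone K q = reg_ncone (tcone K q) 0"
    using arr_near_reg_ncone_tcone[OF cl q near, of 0] r by simp
  ultimately have "reg_ncone K q = {v. \<forall>d\<in>tcone K q. v \<bullet> d \<le> 0}" using arr_cone_reg_ncone_0[OF T] by simp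
  moreover obtain V where "finite V" "{v. \<forall>d\<in>tcone K q. v \<bullet> d \<le> 0} = {v. \<forall>w\<in>V. w \<bullet> v \<le> 0}"
    using arr_cone_polar_finitely_constrained[OF T] .
  ultimately show ?thesis using that by simp
qed

text \<open>Any \<open>p\<close> in the closure is approached from within the cell of
  \<open>q\<close>, along which the regular normal cone is constant.\<close>

lemma reg_ncone_subset_lim_ncone_closed_cell:
  assumes K: "arr_cone F K" and q: "q \<in> K" and p: "p \<in> closed_cell F q"
  shows "reg_ncone K q \<subseteq> lim_ncone K p"
proof
  fix v assume v: "v \<in> reg_ncone K q"
  define x where "x n = p + inverse (real (Suc n)) *\<^sub>R q" for n
  have s: "same_signs F (x n) q" for n
    unfolding x_def by (rule closed_cell_add_same_signs[OF p]) simp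
  have "x \<longlonglongrightarrow> p + 0 *\<^sub>R q" unfolding x_def by (intro tendsto_intros LIMSEQ_inverse_real_of_nat)
  moreover have "v \<in> reg_ncone K (x n)" for n
    using arr_cone_reg_ncone_subset[OF K same_signs_sym[OF s]] v by blast
  ultimately show "v \<in> lim_ncone K p"
    unfolding lim_ncone_def using closed_cell_subset_arr_cone[OF K q] p
    by (intro CollectI conjI exI[of _ x] exI[of _ "\<lambda>_. v"]) (auto simp: reg_ncone_def)
qed

text \<open>Along a subsequence the points \<open>q k\<close> lie in one cell, on which the regular normal cone is a
  constant polyhedral cone; closedness of linear images of polyhedral cones then replaces the
  compactness that the possibly unbounded sequences \<open>s\<close> and \<open>\<mu>\<close> lack.\<close>

lemma arr_cone_normal_limit:
  fixes T :: "'b::euclidean_space set" and A :: "'a::euclidean_space \<Rightarrow> 'b"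
    and B :: "'b \<Rightarrow> 'c::euclidean_space"
  assumes T: "arr_cone F T" and A: "linear A" and B: "linear B"
    and \<mu>: "\<forall>\<^sub>F k in sequentially. \<mu> k \<in> reg_ncone T (q k)"
    and q: "(\<lambda>k. q k - A (s k)) \<longlonglongrightarrow> w0"
    and \<zeta>: "(\<lambda>k. B (\<mu> k)) \<longlonglongrightarrow> \<zeta>"
    and t: "\<forall>\<^sub>F k in sequentially. 0 < t k" "(\<lambda>k. t k *\<^sub>R \<mu> k) \<longlonglongrightarrow> y"
  obtains z s0 where "B z = \<zeta>" "y \<in> lim_ncone T (A s0 + w0)" "\<forall>b. zcond b T (A s0 + w0) y z"
    "z \<in> lim_ncone T 0"
proof -
  have F: "finite F" using T by (simp add: arr_cone_def)
  obtain m where m: "\<And>k. m \<le> k \<Longrightarrow> \<mu> k \<in> reg_ncone T (q k) \<and> 0 < t k"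
    using eventually_conj[OF \<mu> t(1)] unfolding eventually_sequentially by blast
  let ?\<sigma> = "\<lambda>x. restrict (\<lambda>a. sgn (a \<bullet> x)) F"
  have "finite ((\<lambda>k. ?\<sigma> (q k)) ` {m..})"
    by (rule rev_finite_subset[OF finite_sign_classes[OF F]]) auto
  \<comment> \<open>Only finitely many sign vectors occur, so one of them is shared by infinitely
    many indices from \<open>m\<close> on.\<close>
  then obtain k0 where k0: "m \<le> k0" "infinite {k \<in> {m..}. ?\<sigma> (q k) = ?\<sigma> (q k0)}"
    using pigeonhole_infinite[OF infinite_Ici, of "\<lambda>k. ?\<sigma> (q k)" m] by auto
  then obtain h :: "nat \<Rightarrow> nat" where h: "strict_mono h" "\<And>n. ?\<sigma> (q (h n)) = ?\<sigma> (q k0)" "\<And>n. m \<le> h n"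
    using infinite_enumerate[OF k0(2)] by auto
  have qT: "q k0 \<in> T" using m[OF k0(1)] by (simp add: reg_ncone_def)
  have hs: "same_signs F (q (h n)) (q k0)" for n using h(2) by (simp add: same_signs_iff_restrict_eq)
  define N where "N = reg_ncone T (q k0)"
  obtain V where V: "finite V" "N = {v. \<forall>w\<in>V. w \<bullet> v \<le> 0}"
    unfolding N_def using arr_cone_reg_ncone_finitely_constrained[OF T qT] .
  have \<mu>N: "\<mu> (h n) \<in> N" for n
    using arr_cone_reg_ncone_subset[OF T hs] m[OF h(3)] unfolding N_def by blast
  have clN: "closed N"
    using closed_linear_image_finitely_constrained_cone[OF V(1), of id] V(2) by (simp add: linear_id)
  have yN: "y \<in> N"
  proof (rule closed_sequentially[OF clN])
    show "(\<lambda>n. t (h n) *\<^sub>R \<mu> (h n)) \<longlonglongrightarrow> y" using LIMSEQ_subseq_LIMSEQ[OF t(2) h(1)] by (simp add: o_def)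
    show "t (h n) *\<^sub>R \<mu> (h n) \<in> N" for n
      using \<mu>N[of n] m[OF h(3), of n] unfolding V(2) by (simp add: mult_nonneg_nonpos less_imp_le)
  qed
  have "\<zeta> \<in> B ` N"
  proof (rule closed_sequentially)
    show "closed (B ` N)" unfolding V(2) by (rule closed_linear_image_finitely_constrained_cone[OF V(1) B])
    show "(\<lambda>n. B (\<mu> (h n))) \<longlonglongrightarrow> \<zeta>" using LIMSEQ_subseq_LIMSEQ[OF \<zeta> h(1)] by (simp add: o_def)
  qed (use \<mu>N in blast)
  then obtain z where z: "z \<in> N" "B z = \<zeta>" by blast
  obtain W where W: "finite W" "closed_cell F (q k0) = {y. \<forall>w\<in>W. w \<bullet> y \<le> 0}"
    using closed_cell_finitely_constrained[OF F] .
  \<comment> \<open>The differences \<open>q k - A (s k)\<close> lie in a linear image of the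
    polyhedral cone \<open>closed_cell F (q k0) \<times> UNIV\<close>. Closedness of that image
    realises \<open>w0\<close> by some \<open>p\<close> and \<open>s0\<close>, even if
    \<open>s\<close> diverges.\<close>
  let ?f = "\<lambda>(p, s). p - A s"
  have prod: "closed_cell F (q k0) \<times> UNIV = {x. \<forall>w\<in>(\<lambda>w. (w, 0::'a)) ` W. w \<bullet> x \<le> 0}"
    by (auto simp: W(2) inner_prod_def)
  have "w0 \<in> ?f ` (closed_cell F (q k0) \<times> UNIV)"
  proof (rule closed_sequentially)
    have "linear ?f"
      by (rule linearI) (auto simp: linear_add[OF A] linear_scale[OF A] scaleR_diff_right algebra_simps)
    then show "closed (?f ` (closed_cell F (q k0) \<times> UNIV))"
      unfolding prod using W(1) by (intro closed_linear_image_finitely_constrained_cone) auto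
    show "(\<lambda>n. q (h n) - A (s (h n))) \<longlonglongrightarrow> w0" using LIMSEQ_subseq_LIMSEQ[OF q h(1)] by (simp add: o_def)
    fix n
    have "q (h n) \<in> closed_cell F (q k0)"
      using self_in_closed_cell[of "q (h n)" F] same_signs_imp_closed_cell_eq[OF hs[of n]] by simp
    then show "q (h n) - A (s (h n)) \<in> ?f ` (closed_cell F (q k0) \<times> UNIV)" by force
  qed
  then obtain p s0 where p: "p \<in> closed_cell F (q k0)" "w0 = p - A s0" by auto
  have pw: "A s0 + w0 = p" using p by simp
  have sub: "N \<subseteq> lim_ncone T p"
    unfolding N_def by (rule reg_ncone_subset_lim_ncone_closed_cell[OF T qT p(1)])
  \<comment> \<open>Both \<open>y\<close> and \<open>z\<close> lie in the convex cone
    \<open>N\<close>, so the ray from \<open>y\<close> in direction \<open>z\<close> stays among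
    normals at \<open>p\<close>. This gives the tangent variant; \<open>z\<close> being a normal at
    \<open>p\<close> gives the other.\<close>
  have "z \<in> tcone (lim_ncone T p) y"
  proof -
    have "y + inverse (real (Suc n)) *\<^sub>R z \<in> lim_ncone T p" for n
    proof -
      have "w \<bullet> (y + inverse (real (Suc n)) *\<^sub>R z) \<le> 0" if "w \<in> V" for w
      proof -
        have "w \<bullet> y \<le> 0" "w \<bullet> z \<le> 0" using yN z(1) that unfolding V(2) by auto
        then show ?thesis by (simp add: inner_add_right add_nonpos_nonpos divide_nonpos_nonneg mult_nonneg_nonpos)
      qed
      then show ?thesis using sub unfolding V(2) by blast
    qed
    then show ?thesis using yN sub LIMSEQ_inverse_real_of_nat unfolding tcone_def
      by (intro CollectI conjI exI[of _ "\<lambda>n. inverse (real (Suc n))"] exI[of _ "\<lambda>_. z"]) auto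
  qed
  then have "zcond b T p y z" for b using sub z(1) by (auto simp: zcond_def)
  \<comment> \<open>The origin lies in every closed cell.\<close>
  moreover have "z \<in> lim_ncone T 0"
    using reg_ncone_subset_lim_ncone_closed_cell[OF T qT, of 0] z(1)
    unfolding N_def by (auto simp: closed_cell_def)
  ultimately show ?thesis using that[of z s0] z(2) yN sub unfolding pw by blast
qed

section \<open>Normals to the graph and second-order expansions\<close>

text \<open>The coordinate formula makes linearity in the operator and joint continuity immediate,
  and it has the shape of \<open>lag_hess\<close>.\<close>

lemma adjoint_blinfun_eq:
  fixes L :: "'a::euclidean_space \<Rightarrow>\<^sub>L 'b::euclidean_space"
  shows "adjoint (blinfun_apply L) y = (\<Sum>b\<in>Basis. (y \<bullet> L b) *\<^sub>R b)"
proof (rule euclidean_eqI)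
  fix b :: 'a assume "b \<in> Basis"
  have lin: "linear (blinfun_apply L)" by (simp add: blinfun.bounded_linear_right bounded_linear.linear)
  have "adjoint (blinfun_apply L) y \<bullet> b = y \<bullet> L b"
    using adjoint_works[OF lin, of b y] by (simp add: inner_commute)
  then show "adjoint (blinfun_apply L) y \<bullet> b = (\<Sum>b\<in>Basis. (y \<bullet> L b) *\<^sub>R b) \<bullet> b"
    using \<open>b \<in> Basis\<close> by simp
qed

lemma lag_hess_eq_adjoint:
  "lag_hess g2 y u = adjoint (blinfun_apply (blinfun_apply g2 u)) y"
  for y :: "'b::euclidean_space"
  by (simp add: lag_hess_def adjoint_blinfun_eq)

lemma tendsto_adjoint_blinfun:
  fixes L :: "'c \<Rightarrow> 'a::euclidean_space \<Rightarrow>\<^sub>L 'b::euclidean_space"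
  assumes "(L \<longlongrightarrow> L0) F" "(y \<longlongrightarrow> y0) F"
  shows "((\<lambda>k. adjoint (blinfun_apply (L k)) (y k)) \<longlongrightarrow> adjoint (blinfun_apply L0) y0) F"
  unfolding adjoint_blinfun_eq by (intro tendsto_intros assms)

lemma linear_adjoint_blinfun:
  fixes L :: "'a::euclidean_space \<Rightarrow>\<^sub>L 'b::euclidean_space"
  shows "linear (adjoint (blinfun_apply L))"
  by (simp add: adjoint_linear blinfun.bounded_linear_right bounded_linear.linear)

lemma adjoint_blinfun_add_left:
  fixes L M :: "'a::euclidean_space \<Rightarrow>\<^sub>L 'b::euclidean_space"
  shows "adjoint (blinfun_apply (L + M)) y = adjoint (blinfun_apply L) y + adjoint (blinfun_apply M) y"
  by (simp add: adjoint_blinfun_eq blinfun.add_left inner_add_right scaleR_add_left sum.distrib)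

lemma adjoint_blinfun_scaleR_left:
  fixes L :: "'a::euclidean_space \<Rightarrow>\<^sub>L 'b::euclidean_space"
  shows "adjoint (blinfun_apply (c *\<^sub>R L)) y = c *\<^sub>R adjoint (blinfun_apply L) y"
  by (simp add: adjoint_blinfun_eq blinfun.scaleR_left scaleR_sum_right)

section \<open>Regular normals to the graph\<close>

text \<open>Moving only \<open>y\<close> tests \<open>l\<close> against \<open>D\<close>. Moving
  \<open>x\<close> while \<open>y\<close> follows \<open>g\<close> keeps the point of
  \<open>D\<close> fixed, so what remains is \<open>xs - adjoint A l\<close> up to first-order
  errors, and it must vanish.\<close>

lemma reg_ncone_phi_graph_imp:
  fixes g :: "'a::euclidean_space \<Rightarrow> 'b::euclidean_space"
  assumes dg: "(g has_derivative A) (at x)" and N: "(xs, - l) \<in> reg_ncone (phi_graph g D) (x, y)"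
  shows "l \<in> reg_ncone D (g x - y)" "xs = adjoint A l"
proof -
  have G: "g x - y \<in> D" using N by (simp add: reg_ncone_def phi_graph_def)
  have N': "\<exists>\<delta>>0. \<forall>x' y'. g x' - y' \<in> D \<longrightarrow> norm (x' - x, y' - y) < \<delta> \<longrightarrow>
      xs \<bullet> (x' - x) - l \<bullet> (y' - y) \<le> e * norm (x' - x, y' - y)" if e: "e > 0" for e
  proof -
    obtain \<delta> where "\<delta> > 0" and *: "\<forall>p\<in>phi_graph g D. norm (p - (x, y)) < \<delta> \<longrightarrow>
        (xs, - l) \<bullet> (p - (x, y)) \<le> e * norm (p - (x, y))"
      using N e unfolding reg_ncone_def by blast
    have "xs \<bullet> (x' - x) - l \<bullet> (y' - y) \<le> e * norm (x' - x, y' - y)"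
      if "g x' - y' \<in> D" "norm (x' - x, y' - y) < \<delta>" for x' y'
      using bspec[OF *, of "(x', y')"] that by (simp add: phi_graph_def)
    then show ?thesis using \<open>\<delta> > 0\<close> by blast
  qed
  show "l \<in> reg_ncone D (g x - y)"
    unfolding reg_ncone_def
  proof (intro CollectI conjI allI impI)
    fix e :: real assume "e > 0"
    then obtain \<delta> where \<delta>: "\<delta> > 0" "\<And>x' y'. g x' - y' \<in> D \<Longrightarrow> norm (x' - x, y' - y) < \<delta> \<Longrightarrow>
      xs \<bullet> (x' - x) - l \<bullet> (y' - y) \<le> e * norm (x' - x, y' - y)" using N' by blast
    have "l \<bullet> (w - (g x - y)) \<le> e * norm (w - (g x - y))" if w: "w \<in> D" "norm (w - (g x - y)) < \<delta>" for w
    proof -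
      have eq: "(g x - w) - y = - (w - (g x - y))" by simp
      have "norm (x - x, (g x - w) - y) = norm (w - (g x - y))"
        unfolding eq by (simp add: norm_Pair norm_minus_commute)
      moreover have "l \<bullet> ((g x - w) - y) = - (l \<bullet> (w - (g x - y)))" unfolding eq by (rule inner_minus_right)
      ultimately show ?thesis using \<delta>(2)[of x "g x - w"] w by simp
    qed
    then show "\<exists>\<delta>>0. \<forall>x'\<in>D. norm (x' - (g x - y)) < \<delta> \<longrightarrow>
        l \<bullet> (x' - (g x - y)) \<le> e * norm (x' - (g x - y))" using \<delta>(1) by blast
  qed (rule G)
  have bl: "bounded_linear A" using dg by (rule has_derivative_bounded_linear)
  have lin: "linear A" using bl by (rule bounded_linear.linear)
  obtain M where M: "M > 0" "\<And>h. norm (A h) \<le> norm h * M" using bounded_linear.pos_bounded[OF bl] by blast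
  define p where "p = xs - adjoint A l"
  show "xs = adjoint A l"
  proof (rule ccontr)
    assume "xs \<noteq> adjoint A l"
    then have p: "norm p > 0" by (simp add: p_def)
    \<comment> \<open>\<open>e\<close> and \<open>\<epsilon>\<close> make the normality error and
      the term \<open>l \<bullet> \<rho>\<close> cost at most a quarter of
      \<open>norm p * norm h\<close> each. The factor \<open>M + 2\<close> bounds the graph
      displacement relative to \<open>norm h\<close>, using
      \<open>\<epsilon> \<le> 1\<close>.\<close>
    define e where "e = norm p / (4 * (M + 2))"
    define \<epsilon> where "\<epsilon> = min 1 (norm p / (4 * (norm l + 1)))"
    have l1: "norm l + 1 > 0" by (simp add: add_nonneg_pos)
    have "e > 0" using p M by (simp add: e_def)
    have "\<epsilon> > 0" using p l1 by (simp add: \<epsilon>_def)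
    obtain \<delta> where \<delta>: "\<delta> > 0" "\<And>x' y'. g x' - y' \<in> D \<Longrightarrow> norm (x' - x, y' - y) < \<delta> \<Longrightarrow>
      xs \<bullet> (x' - x) - l \<bullet> (y' - y) \<le> e * norm (x' - x, y' - y)" using N'[OF \<open>e > 0\<close>] by blast
    obtain d where d: "d > 0" "\<And>x'. norm (x' - x) < d \<Longrightarrow> norm (g x' - g x - A (x' - x)) \<le> \<epsilon> * norm (x' - x)"
      using dg \<open>\<epsilon> > 0\<close> unfolding has_derivative_at_alt by blast
    have "0 < min d (\<delta> / (M + 2))" using d \<delta> M by simp
    then obtain s where s: "0 < s" "norm (s *\<^sub>R p) < min d (\<delta> / (M + 2))" using small_scaling[of _ p p] by blast
    define h where "h = s *\<^sub>R p"
    define \<rho> where "\<rho> = g (x + h) - g x - A h"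
    have h: "norm h > 0" "norm h < d" "norm h < \<delta> / (M + 2)" using s p by (auto simp: h_def)
    have \<rho>: "norm \<rho> \<le> \<epsilon> * norm h" using d(2)[of "x + h"] h by (simp add: \<rho>_def)
    have "\<epsilon> \<le> 1" by (simp add: \<epsilon>_def)
    then have \<rho>1: "norm \<rho> \<le> norm h" using \<rho> h(1) mult_right_mono[of \<epsilon> 1 "norm h"] by linarith
    have "norm (h, A h + \<rho>) \<le> norm h + norm (A h + \<rho>)" by (rule norm_Pair_le)
    also have "\<dots> \<le> norm h + (norm h * M + norm h)" using norm_triangle_ineq[of "A h" \<rho>] M(2)[of h] \<rho>1 by simp
    also have "\<dots> = (M + 2) * norm h" by (simp add: algebra_simps)
    finally have n: "norm (h, A h + \<rho>) \<le> (M + 2) * norm h" .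
    have "(M + 2) * norm h < \<delta>" using h(3) M(1) by (simp add: field_simps)
    \<comment> \<open>The \<open>y\<close>-displacement \<open>A h + \<rho>\<close> is exactly the
      increment of \<open>g\<close>, so the new pair stays on the graph.\<close>
    moreover have "g (x + h) - (y + (A h + \<rho>)) = g x - y" by (simp add: \<rho>_def)
    then have "g (x + h) - (y + (A h + \<rho>)) \<in> D" using G by (simp only:)
    ultimately have "xs \<bullet> h - l \<bullet> (A h + \<rho>) \<le> e * norm (h, A h + \<rho>)"
      using \<delta>(2)[of "x + h" "y + (A h + \<rho>)"] n by simp
    also have "\<dots> \<le> e * ((M + 2) * norm h)" using n \<open>e > 0\<close> by (intro mult_left_mono) auto
    also have "\<dots> = norm p / 4 * norm h" using M(1) by (simp add: e_def divide_simps)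
    finally have 1: "xs \<bullet> h - l \<bullet> (A h + \<rho>) \<le> norm p / 4 * norm h" .
    have "l \<bullet> \<rho> \<le> norm l * norm \<rho>" by (rule norm_cauchy_schwarz)
    also have "\<dots> \<le> (norm l + 1) * (norm p / (4 * (norm l + 1)) * norm h)"
    proof (rule mult_mono)
      have "\<epsilon> * norm h \<le> norm p / (4 * (norm l + 1)) * norm h"
        by (intro mult_right_mono) (auto simp: \<epsilon>_def)
      then show "norm \<rho> \<le> norm p / (4 * (norm l + 1)) * norm h" using \<rho> by simp
    qed auto
    also have "\<dots> = norm p / 4 * norm h" using l1 by (simp add: field_simps)
    finally have 2: "l \<bullet> \<rho> \<le> norm p / 4 * norm h" .
    have "xs \<bullet> h - l \<bullet> A h = p \<bullet> h"
      using adjoint_works[OF lin, of h l] by (simp add: p_def inner_diff_right inner_commute)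
    also have "\<dots> = norm p * norm h" using s(1) by (simp add: h_def dot_square_norm power2_eq_square)
    finally have "norm p * norm h \<le> norm p * norm h / 2"
      using 1 2 unfolding inner_add_right times_divide_eq_left by linarith
    then show False using mult_pos_pos[OF p h(1)] by linarith
  qed
qed

text \<open>Pairing with \<open>(h, k)\<close> gives
  \<open>l \<bullet> (A h + \<rho> - k) - l \<bullet> \<rho>\<close>. The first term tests
  \<open>l\<close> on a displacement within \<open>D\<close>, the second is a differentiation error,
  and each is given half of \<open>e\<close>.\<close>

lemma reg_ncone_phi_graphI:
  fixes g :: "'a::euclidean_space \<Rightarrow> 'b::euclidean_space"
  assumes dg: "(g has_derivative A) (at x)" and l: "l \<in> reg_ncone D (g x - y)"
  shows "(adjoint A l, - l) \<in> reg_ncone (phi_graph g D) (x, y)"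
proof -
  have bl: "bounded_linear A" using dg by (rule has_derivative_bounded_linear)
  have lin: "linear A" using bl by (rule bounded_linear.linear)
  obtain M where M: "M > 0" "\<And>h. norm (A h) \<le> norm h * M" using bounded_linear.pos_bounded[OF bl] by blast
  show ?thesis
    unfolding reg_ncone_def
  proof (intro CollectI conjI allI impI)
    show "(x, y) \<in> phi_graph g D" using l by (simp add: reg_ncone_def phi_graph_def)
    fix e :: real assume "e > 0"
    define e1 where "e1 = e / (2 * (M + 2))"
    define \<epsilon> where "\<epsilon> = min 1 (e / (2 * (norm l + 1)))"
    have l1: "norm l + 1 > 0" by (simp add: add_nonneg_pos)
    have "e1 > 0" using \<open>e > 0\<close> M by (simp add: e1_def)
    have "\<epsilon> > 0" using \<open>e > 0\<close> l1 by (simp add: \<epsilon>_def)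
    obtain \<delta> where \<delta>: "\<delta> > 0" "\<And>w. w \<in> D \<Longrightarrow> norm (w - (g x - y)) < \<delta> \<Longrightarrow>
        l \<bullet> (w - (g x - y)) \<le> e1 * norm (w - (g x - y))"
      using l \<open>e1 > 0\<close> unfolding reg_ncone_def by blast
    obtain d where d: "d > 0" "\<And>x'. norm (x' - x) < d \<Longrightarrow> norm (g x' - g x - A (x' - x)) \<le> \<epsilon> * norm (x' - x)"
      using dg \<open>\<epsilon> > 0\<close> unfolding has_derivative_at_alt by blast
    show "\<exists>\<delta>>0. \<forall>p\<in>phi_graph g D. norm (p - (x, y)) < \<delta> \<longrightarrow>
        (adjoint A l, - l) \<bullet> (p - (x, y)) \<le> e * norm (p - (x, y))"
    proof (intro exI[of _ "min d (\<delta> / (M + 2))"] conjI ballI impI)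
      show "0 < min d (\<delta> / (M + 2))" using d \<delta> M by simp
      fix p assume p: "p \<in> phi_graph g D" "norm (p - (x, y)) < min d (\<delta> / (M + 2))"
      obtain x' y' where p': "p = (x', y')" by (cases p)
      define h where "h = x' - x"
      define k where "k = y' - y"
      define n where "n = norm (h, k)"
      define \<rho> where "\<rho> = g x' - g x - A h"
      have pn: "p - (x, y) = (h, k)" by (simp add: p' h_def k_def)
      have n: "n < d" "n < \<delta> / (M + 2)" "0 \<le> n" using p(2) by (auto simp: pn n_def)
      have hk: "norm h \<le> n" "norm k \<le> n"
        using norm_fst_le[of h k] norm_snd_le[of k h] by (auto simp: n_def)
      have \<rho>: "norm \<rho> \<le> \<epsilon> * norm h" using d(2)[of x'] hk n by (simp add: \<rho>_def h_def)
      have "\<epsilon> \<le> 1" by (simp add: \<epsilon>_def)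
      then have \<rho>1: "norm \<rho> \<le> n" using \<rho> hk mult_right_mono[of \<epsilon> 1 "norm h"] by simp
      have w: "(g x' - y') - (g x - y) = A h + \<rho> - k" by (simp add: \<rho>_def k_def)
      have "norm (A h) \<le> n * M" using M(2)[of h] mult_right_mono[OF hk(1), of M] M(1) by linarith
      then have wn: "norm (A h + \<rho> - k) \<le> (M + 2) * n"
        using norm_triangle_ineq4[of "A h + \<rho>" k] norm_triangle_ineq[of "A h" \<rho>] \<rho>1 hk
        by (simp add: algebra_simps)
      have "(M + 2) * n < \<delta>" using n(2) M(1) by (simp add: field_simps)
      moreover have "g x' - y' \<in> D" using p(1) by (simp add: p' phi_graph_def)
      ultimately have "l \<bullet> (A h + \<rho> - k) \<le> e1 * norm (A h + \<rho> - k)"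
        using \<delta>(2)[of "g x' - y'"] wn unfolding w by simp
      also have "\<dots> \<le> e1 * ((M + 2) * n)" using wn \<open>e1 > 0\<close> by (intro mult_left_mono) auto
      also have "\<dots> = e / 2 * n" using M(1) by (simp add: e1_def divide_simps)
      finally have 1: "l \<bullet> (A h + \<rho> - k) \<le> e / 2 * n" .
      have "- (l \<bullet> \<rho>) \<le> norm l * norm \<rho>" using norm_cauchy_schwarz[of "- l" \<rho>] by simp
      also have "\<dots> \<le> (norm l + 1) * (e / (2 * (norm l + 1)) * n)"
      proof (rule mult_mono)
        have "\<epsilon> * norm h \<le> e / (2 * (norm l + 1)) * n"
          using hk \<open>e > 0\<close> by (intro mult_mono) (auto simp: \<epsilon>_def)
        then show "norm \<rho> \<le> e / (2 * (norm l + 1)) * n" using \<rho> by simp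
      qed auto
      also have "\<dots> = e / 2 * n" using l1 by (simp add: field_simps)
      finally have 2: "- (l \<bullet> \<rho>) \<le> e / 2 * n" .
      have "(adjoint A l, - l) \<bullet> (h, k) = l \<bullet> A h - l \<bullet> k"
        using adjoint_works[OF lin, of h l] by (simp add: inner_commute)
      also have "\<dots> = l \<bullet> (A h + \<rho> - k) - l \<bullet> \<rho>" by (simp add: inner_add_right inner_diff_right)
      also have "\<dots> \<le> e * n" using 1 2 by simp
      finally show "(adjoint A l, - l) \<bullet> (p - (x, y)) \<le> e * norm (p - (x, y))" by (simp add: pn n_def)
    qed
  qed
qed

section \<open>First- and second-order difference quotients\<close>

lemma scaled_remainder_tendsto_0:
  fixes R :: "'a::real_normed_vector \<Rightarrow> 'b::real_normed_vector"
  assumes R: "\<And>e. 0 < e \<Longrightarrow> \<exists>\<delta>>0. \<forall>h. norm h < \<delta> \<longrightarrow> norm (R h) \<le> e * norm h ^ p"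
    and t: "t \<longlonglongrightarrow> 0" "\<forall>\<^sub>F k in sequentially. 0 < t k" and u: "uk \<longlonglongrightarrow> u"
  shows "(\<lambda>k. (1 / t k ^ p) *\<^sub>R R (t k *\<^sub>R uk k)) \<longlonglongrightarrow> 0"
proof (rule tendstoI)
  fix e :: real assume "e > 0"
  \<comment> \<open>Eventually \<open>norm (uk k) ^ p \<le> B\<close>; the extra factor 2 leaves
    room for a strict inequality.\<close>
  define B where "B = (norm u + 1) ^ p"
  have B: "B > 0" by (simp add: B_def add_nonneg_pos)
  then obtain \<delta> where \<delta>: "\<delta> > 0" "\<And>h. norm h < \<delta> \<Longrightarrow> norm (R h) \<le> e / (2 * B) * norm h ^ p"
    using R[of "e / (2 * B)"] \<open>e > 0\<close> by auto
  have "(\<lambda>k. t k *\<^sub>R uk k) \<longlonglongrightarrow> 0 *\<^sub>R u" by (intro tendsto_intros t u)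
  then have "\<forall>\<^sub>F k in sequentially. dist (t k *\<^sub>R uk k) (0 *\<^sub>R u) < \<delta>" using \<delta>(1) by (rule tendstoD)
  moreover have "\<forall>\<^sub>F k in sequentially. norm (uk k) < norm u + 1"
    by (rule order_tendstoD(2)[OF tendsto_norm[OF u]]) simp
  ultimately show "\<forall>\<^sub>F k in sequentially. dist ((1 / t k ^ p) *\<^sub>R R (t k *\<^sub>R uk k)) 0 < e"
    using t(2)
  proof eventually_elim
    case (elim k)
    have "norm (R (t k *\<^sub>R uk k)) \<le> e / (2 * B) * norm (t k *\<^sub>R uk k) ^ p"
      using elim by (intro \<delta>(2)) simp
    also have "\<dots> = t k ^ p * (e / (2 * B) * norm (uk k) ^ p)" using elim by (simp add: power_mult_distrib)
    also have "\<dots> \<le> t k ^ p * (e / (2 * B) * B)"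
      using elim B \<open>e > 0\<close> unfolding B_def by (intro mult_left_mono power_mono) auto
    also have "\<dots> = t k ^ p * (e / 2)" using B by simp
    finally have "norm (R (t k *\<^sub>R uk k)) \<le> t k ^ p * (e / 2)" .
    then have "norm ((1 / t k ^ p) *\<^sub>R R (t k *\<^sub>R uk k)) \<le> e / 2"
      using elim by (simp add: divide_simps mult.commute)
    also have "e / 2 < e" using \<open>e > 0\<close> by simp
    finally show ?case unfolding dist_0_norm dist_commute[of _ 0] .
  qed
qed

lemma has_derivative_quotient_tendsto:
  fixes f :: "'a::real_normed_vector \<Rightarrow> 'b::real_normed_vector"
  assumes f: "(f has_derivative f') (at x)"
    and t: "t \<longlonglongrightarrow> 0" "\<forall>\<^sub>F k in sequentially. 0 < t k" and u: "uk \<longlonglongrightarrow> u"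
  shows "(\<lambda>k. (1 / t k) *\<^sub>R (f (x + t k *\<^sub>R uk k) - f x)) \<longlonglongrightarrow> f' u"
proof -
  have bl: "bounded_linear f'" using f by (rule has_derivative_bounded_linear)
  have "(\<lambda>k. (1 / t k ^ 1) *\<^sub>R (f (x + t k *\<^sub>R uk k) - f x - f' (t k *\<^sub>R uk k))) \<longlonglongrightarrow> 0"
  proof (rule scaled_remainder_tendsto_0[OF _ t u])
    fix e :: real assume "0 < e"
    then obtain \<delta> where "\<delta> > 0" "\<And>y. norm (y - x) < \<delta> \<Longrightarrow> norm (f y - f x - f' (y - x)) \<le> e * norm (y - x)"
      using f unfolding has_derivative_at_alt by blast
    then have "\<forall>h. norm h < \<delta> \<longrightarrow> norm (f (x + h) - f x - f' h) \<le> e * norm h ^ 1"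
      by (metis add_diff_cancel_left' power_one_right)
    then show "\<exists>\<delta>>0. \<forall>h. norm h < \<delta> \<longrightarrow> norm (f (x + h) - f x - f' h) \<le> e * norm h ^ 1"
      using \<open>\<delta> > 0\<close> by blast
  qed
  then have "(\<lambda>k. (1 / t k ^ 1) *\<^sub>R (f (x + t k *\<^sub>R uk k) - f x - f' (t k *\<^sub>R uk k)) + f' (uk k)) \<longlonglongrightarrow> 0 + f' u"
    by (intro tendsto_add bounded_linear.tendsto[OF bl] u)
  moreover have "\<forall>\<^sub>F k in sequentially.
      (1 / t k ^ 1) *\<^sub>R (f (x + t k *\<^sub>R uk k) - f x - f' (t k *\<^sub>R uk k)) + f' (uk k) = (1 / t k) *\<^sub>R (f (x + t k *\<^sub>R uk k) - f x)"
    using t(2)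
    by eventually_elim (simp add: linear_scale[OF bounded_linear.linear[OF bl]] scaleR_diff_right)
  ultimately show ?thesis by (simp add: tendsto_cong)
qed

text \<open>Restricting to a segment, where only \<open>g2 h h\<close> enters, avoids the symmetry of the second
  derivative.\<close>

lemma second_order_remainder:
  fixes g :: "'a::real_normed_vector \<Rightarrow> 'b::real_normed_vector"
  assumes dg: "\<And>x. (g has_derivative blinfun_apply (g' x)) (at x)"
    and d2g: "(g' has_derivative blinfun_apply g2) (at x)" and "0 < e"
  shows "\<exists>\<delta>>0. \<forall>h. norm h < \<delta> \<longrightarrow>
    norm (g (x + h) - g x - g' x h - (1/2) *\<^sub>R g2 h h) \<le> e * norm h ^ 2"
proof -
  obtain \<delta> where \<delta>: "\<delta> > 0" "\<And>y. norm (y - x) < \<delta> \<Longrightarrow> norm (g' y - g' x - g2 (y - x)) \<le> e * norm (y - x)"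
    using d2g \<open>0 < e\<close> unfolding has_derivative_at_alt by blast
  have "norm (g (x + h) - g x - g' x h - (1/2) *\<^sub>R g2 h h) \<le> e * norm h ^ 2" if h: "norm h < \<delta>" for h
  proof -
    \<comment> \<open>\<open>f\<close> is \<open>g\<close> along the segment minus its first- and
      second-order terms, so \<open>f 1 - f 0\<close> is the remainder. Differentiability of
      \<open>g'\<close> bounds its derivative by \<open>e * norm h ^ 2\<close>.\<close>
    define f where "f \<tau> = g (x + \<tau> *\<^sub>R h) - \<tau> *\<^sub>R g' x h - (\<tau>\<^sup>2 / 2) *\<^sub>R g2 h h" for \<tau> :: real
    define f' where "f' \<tau> s = s *\<^sub>R ((g' (x + \<tau> *\<^sub>R h) - g' x - g2 (\<tau> *\<^sub>R h)) h)" for \<tau> s :: real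
    have "norm (f 1 - f 0) \<le> (e * norm h ^ 2) * norm (1 - 0 :: real)"
    proof (rule differentiable_bound[where S="{0..1}" and f'=f'])
      fix \<tau> :: real assume \<tau>: "\<tau> \<in> {0..1}"
      have "((\<lambda>\<tau>. g (x + \<tau> *\<^sub>R h)) has_derivative (\<lambda>s. g' (x + \<tau> *\<^sub>R h) (s *\<^sub>R h))) (at \<tau> within {0..1})"
        by (rule has_derivative_compose[OF _ dg]) (auto intro!: derivative_eq_intros)
      then show "(f has_derivative f' \<tau>) (at \<tau> within {0..1})"
        unfolding f_def f'_def
        by (auto intro!: derivative_eq_intros simp: fun_eq_iff blinfun.diff_left blinfun.add_left
            blinfun.scaleR_right blinfun.scaleR_left algebra_simps)
      have "norm (\<tau> *\<^sub>R h) \<le> norm h" using \<tau> by (simp add: mult_left_le_one_le)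
      then have "norm (g' (x + \<tau> *\<^sub>R h) - g' x - g2 (\<tau> *\<^sub>R h)) \<le> e * norm h"
        using \<delta>(2)[of "x + \<tau> *\<^sub>R h"] h \<open>0 < e\<close> by (auto intro: order_trans mult_left_mono)
      then have *: "norm ((g' (x + \<tau> *\<^sub>R h) - g' x - g2 (\<tau> *\<^sub>R h)) h) \<le> e * norm h * norm h"
        by (meson mult_right_mono norm_blinfun norm_ge_zero order_trans)
      have "norm (f' \<tau> s) \<le> e * norm h ^ 2 * norm s" for s
        using mult_left_mono[OF * abs_ge_zero[of s]] by (simp add: f'_def power2_eq_square mult_ac)
      then show "onorm (f' \<tau>) \<le> e * norm h ^ 2" by (rule onorm_le)
    qed auto
    then show ?thesis by (simp add: f_def algebra_simps)
  qed
  then show ?thesis using \<delta>(1) by blast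
qed

text \<open>The linear term is kept along \<open>uk k\<close> rather than \<open>u\<close>, since
  \<open>(uk k - u) / t k\<close> need not converge; that quotient is later absorbed into the free
  vector \<open>s\<close>.\<close>

lemma second_order_quotient_tendsto:
  fixes g :: "'a::real_normed_vector \<Rightarrow> 'b::real_normed_vector"
  assumes dg: "\<And>x. (g has_derivative blinfun_apply (g' x)) (at x)"
    and d2g: "(g' has_derivative blinfun_apply g2) (at x)"
    and t: "t \<longlonglongrightarrow> 0" "\<forall>\<^sub>F k in sequentially. 0 < t k" and u: "uk \<longlonglongrightarrow> u"
  shows "(\<lambda>k. (1 / (t k)\<^sup>2) *\<^sub>R (g (x + t k *\<^sub>R uk k) - g x - t k *\<^sub>R g' x (uk k))) \<longlonglongrightarrow> (1/2) *\<^sub>R g2 u u"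
proof -
  let ?R = "\<lambda>h. g (x + h) - g x - g' x h - (1/2) *\<^sub>R g2 h h"
  have "(\<lambda>k. (1 / (t k)\<^sup>2) *\<^sub>R ?R (t k *\<^sub>R uk k)) \<longlonglongrightarrow> 0"
    by (rule scaled_remainder_tendsto_0[OF second_order_remainder[OF dg d2g] t u])
  then have "(\<lambda>k. (1 / (t k)\<^sup>2) *\<^sub>R ?R (t k *\<^sub>R uk k) + (1/2) *\<^sub>R g2 (uk k) (uk k)) \<longlonglongrightarrow> 0 + (1/2) *\<^sub>R g2 u u"
    by (intro tendsto_intros u)
  moreover have "\<forall>\<^sub>F k in sequentially.
      (1 / (t k)\<^sup>2) *\<^sub>R ?R (t k *\<^sub>R uk k) + (1/2) *\<^sub>R g2 (uk k) (uk k)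
      = (1 / (t k)\<^sup>2) *\<^sub>R (g (x + t k *\<^sub>R uk k) - g x - t k *\<^sub>R g' x (uk k))"
    using t(2)
    by eventually_elim (simp add: blinfun.scaleR_left blinfun.scaleR_right scaleR_diff_right power2_eq_square)
  ultimately show ?thesis by (simp add: tendsto_cong)
qed

section \<open>Asymptotic multipliers\<close>

locale polyhedral_constraint =
  fixes g :: "'a::euclidean_space \<Rightarrow> 'b::euclidean_space"
    and g' :: "'a \<Rightarrow> 'a \<Rightarrow>\<^sub>L 'b"
    and g2 :: "'a \<Rightarrow>\<^sub>L 'a \<Rightarrow>\<^sub>L 'b"
    and D :: "'b set"
    and xbar u :: 'a
  assumes dg: "\<And>x. (g has_derivative blinfun_apply (g' x)) (at x)"
    and d2g: "(g' has_derivative blinfun_apply g2) (at xbar)"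
    and closedD: "closed D"
    and polyD: "locally_polyhedral_at D (g xbar)"
    and inD: "g xbar \<in> D"
begin

abbreviation "A \<equiv> blinfun_apply (g' xbar)"
abbreviation "K \<equiv> tcone D (g xbar)"
abbreviation "T \<equiv> tcone K (A u)"

lemma continuous_g': "isCont g' xbar"
  using d2g by (rule has_derivative_continuous)

lemma lim_ncone_K_subset: "lim_ncone K d \<subseteq> lim_ncone D (g xbar)"
proof -
  obtain F r where "arr_near F D (g xbar) r" using locally_polyhedral_imp_arr_near[OF polyD] .
  then show ?thesis by (rule lim_ncone_tcone_subset[OF closedD inD])
qed

lemma lim_ncone_T_subset:
  assumes "A u \<in> K"
  shows "lim_ncone T d \<subseteq> lim_ncone K (A u)"
proof -
  obtain F r where "arr_near F D (g xbar) r" using locally_polyhedral_imp_arr_near[OF polyD] .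
  then have K: "arr_cone F K" by (rule arr_cone_tcone[OF closedD inD])
  obtain r' where "arr_near F K (A u) r'" using arr_cone_imp_near[OF K] .
  then show ?thesis using K assms by (intro lim_ncone_tcone_subset) (auto simp: arr_cone_def)
qed

section \<open>From normals of \<open>D\<close> and \<open>K\<close> to coderivatives\<close>

text \<open>With \<open>x\<close> frozen at \<open>xbar\<close>, the points
  \<open>(xbar, g xbar - dk k)\<close> reach every nearby point of \<open>D\<close>, so regular
  normals to \<open>D\<close> lift to the graph.\<close>

lemma lim_coderivI:
  assumes l: "l \<in> lim_ncone D (g xbar)"
  shows "adjoint A l \<in> lim_coderiv (phi_graph g D) xbar 0 l"
proof -
  obtain dk vk where k: "\<And>k. dk k \<in> D" "\<And>k. vk k \<in> reg_ncone D (dk k)" "dk \<longlonglongrightarrow> g xbar" "vk \<longlonglongrightarrow> l"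
    using l unfolding lim_ncone_def by blast
  have G: "(adjoint A (vk k), - vk k) \<in> reg_ncone (phi_graph g D) (xbar, g xbar - dk k)" for k
    by (rule reg_ncone_phi_graphI[OF dg]) (simp add: k)
  have "(\<lambda>k. (xbar, g xbar - dk k)) \<longlonglongrightarrow> (xbar, g xbar - g xbar)" by (intro tendsto_intros k)
  moreover have "(\<lambda>k. (adjoint A (vk k), - vk k)) \<longlonglongrightarrow> (adjoint A l, - l)"
    by (intro tendsto_intros tendsto_adjoint_blinfun k)
  ultimately show ?thesis using G k(1) inD unfolding lim_coderiv_def lim_ncone_def
    by (intro CollectI conjI exI[of _ "\<lambda>k. (xbar, g xbar - dk k)"] exI[of _ "\<lambda>k. (adjoint A (vk k), - vk k)"])
      (auto simp: phi_graph_def)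
qed

text \<open>Normals to \<open>K\<close> near \<open>A u\<close> are normals to \<open>D\<close> at
  \<open>g xbar + t k *\<^sub>R dk k\<close>. Moving along \<open>xbar + t k *\<^sub>R u\<close>,
  the required \<open>y\<close> is of order smaller than \<open>t k\<close>, since \<open>dk\<close>
  also tends to \<open>A u\<close>.\<close>

lemma dir_coderivI:
  assumes l: "l \<in> lim_ncone K (A u)"
  shows "adjoint A l \<in> dir_coderiv (phi_graph g D) xbar 0 u 0 l"
proof -
  obtain dk vk where k: "\<And>k. vk k \<in> reg_ncone K (dk k)" "dk \<longlonglongrightarrow> A u" "vk \<longlonglongrightarrow> l"
    using l unfolding lim_ncone_def by blast
  obtain F r where near: "arr_near F D (g xbar) r" using locally_polyhedral_imp_arr_near[OF polyD] .
  have K: "arr_cone F K" using near by (rule arr_cone_tcone[OF closedD inD])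
  have r: "0 < r" using near by (simp add: arr_near_def)
  obtain B where B: "B > 0" "\<And>k. norm (dk k) \<le> B"
    using convergent_imp_Bseq[OF convergentI[OF k(2)]] unfolding Bseq_def by blast
  define t where "t k = (r / (2 * B)) * inverse (real (Suc k))" for k
  have t0: "0 < t k" for k using r B by (simp add: t_def)
  have tlim: "t \<longlonglongrightarrow> 0"
    unfolding t_def using tendsto_mult[OF tendsto_const LIMSEQ_inverse_real_of_nat, of "r / (2 * B)"] by simp
  have "norm (t k *\<^sub>R dk k) < r" for k
  proof -
    have "t k \<le> r / (2 * B) * 1"
      unfolding t_def using r B by (intro mult_left_mono) (auto simp: field_simps)
    then have "t k * norm (dk k) \<le> r / (2 * B) * B"
      using B t0[of k] r by (intro mult_mono) auto
    also have "\<dots> < r" using r B by simp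
    finally show ?thesis using t0[of k] by simp
  qed
  then have vD: "vk k \<in> reg_ncone D (g xbar + t k *\<^sub>R dk k)" for k
    using arr_near_reg_ncone_tcone[OF closedD inD near] arr_cone_reg_ncone_scaleR[OF K t0] k(1) by blast
  \<comment> \<open>The unique second component for which the graph point at
    \<open>xbar + t k *\<^sub>R u\<close> corresponds to \<open>g xbar + t k *\<^sub>R dk k\<close>
    in \<open>D\<close>.\<close>
  define w where "w k = (1 / t k) *\<^sub>R (g (xbar + t k *\<^sub>R u) - g xbar) - dk k" for k
  have tw: "t k *\<^sub>R w k = g (xbar + t k *\<^sub>R u) - (g xbar + t k *\<^sub>R dk k)" for k
    using t0[of k] by (simp add: w_def scaleR_diff_right)
  have "w \<longlonglongrightarrow> A u - A u"
    unfolding w_def using t0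
    by (intro tendsto_diff k(2) has_derivative_quotient_tendsto[OF dg tlim] always_eventually) auto
  then have wlim: "(\<lambda>k. (u, w k)) \<longlonglongrightarrow> (u, 0)" by (intro tendsto_intros) simp
  have "(\<lambda>k. xbar + t k *\<^sub>R u) \<longlonglongrightarrow> xbar + 0 *\<^sub>R u" by (intro tendsto_intros tlim)
  then have "(\<lambda>k. g' (xbar + t k *\<^sub>R u)) \<longlonglongrightarrow> g' xbar"
    using isCont_tendsto_compose[OF continuous_g'] by simp
  then have nlim: "(\<lambda>k. (adjoint (blinfun_apply (g' (xbar + t k *\<^sub>R u))) (vk k), - vk k)) \<longlonglongrightarrow> (adjoint A l, - l)"
    by (intro tendsto_intros tendsto_adjoint_blinfun k)
  have "(adjoint (blinfun_apply (g' (xbar + t k *\<^sub>R u))) (vk k), - vk k)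
      \<in> reg_ncone (phi_graph g D) ((xbar, 0) + t k *\<^sub>R (u, w k))" for k
    using reg_ncone_phi_graphI[OF dg, of "vk k" D "xbar + t k *\<^sub>R u" "t k *\<^sub>R w k"] vD[of k]
    by (simp add: tw add.commute)
  then show ?thesis unfolding dir_coderiv_def dir_ncone_def using t0 tlim wlim nlim
    by (intro CollectI exI[of _ t] exI[of _ "\<lambda>k. (u, w k)"]
        exI[of _ "\<lambda>k. (adjoint (blinfun_apply (g' (xbar + t k *\<^sub>R u))) (vk k), - vk k)"]) auto
qed

section \<open>Limits of rescaled multipliers\<close>

text \<open>Two blow-ups. Centering at \<open>g xbar\<close> and dividing by \<open>t k\<close>
  gives points of \<open>K\<close> tending to \<open>A u\<close>; centering at \<open>A u\<close>
  and dividing again gives the second-order quotients in \<open>T\<close>. Regular normals survive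
  both.\<close>

lemma eventually_reg_ncone_T:
  assumes t: "t \<longlonglongrightarrow> 0" "\<forall>\<^sub>F k in sequentially. 0 < t k" and uk: "uk \<longlonglongrightarrow> u"
    and yk: "(\<lambda>k. (1 / t k) *\<^sub>R yk k) \<longlonglongrightarrow> 0"
    and l: "\<And>k. lk k \<in> reg_ncone D (g (xbar + t k *\<^sub>R uk k) - yk k)"
  shows "A u \<in> K" "\<exists>F. arr_cone F T"
    "\<forall>\<^sub>F k in sequentially. lk k \<in> reg_ncone T
       ((1 / (t k)\<^sup>2) *\<^sub>R (g (xbar + t k *\<^sub>R uk k) - g xbar - yk k - t k *\<^sub>R A u))"
proof -
  obtain F r where near: "arr_near F D (g xbar) r" using locally_polyhedral_imp_arr_near[OF polyD] .
  have K: "arr_cone F K" using near by (rule arr_cone_tcone[OF closedD inD])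
  have clK: "closed K" using K by (simp add: arr_cone_def)
  have r: "0 < r" using near by (simp add: arr_near_def)
  define e where "e k = g (xbar + t k *\<^sub>R uk k) - g xbar - yk k" for k
  define p where "p k = (1 / t k) *\<^sub>R e k" for k
  have "(\<lambda>k. (1 / t k) *\<^sub>R (g (xbar + t k *\<^sub>R uk k) - g xbar) - (1 / t k) *\<^sub>R yk k) \<longlonglongrightarrow> A u - 0"
    by (intro tendsto_diff has_derivative_quotient_tendsto[OF dg t uk] yk)
  then have plim: "p \<longlonglongrightarrow> A u" unfolding p_def e_def by (simp add: scaleR_diff_right)
  have "(\<lambda>k. t k *\<^sub>R p k) \<longlonglongrightarrow> 0 *\<^sub>R A u" by (intro tendsto_intros t plim)
  then have "(\<lambda>k. norm (t k *\<^sub>R p k)) \<longlonglongrightarrow> 0" using tendsto_norm_zero by fastforce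
  then have "\<forall>\<^sub>F k in sequentially. norm (t k *\<^sub>R p k) < r" using r by (rule order_tendstoD(2))
  with t(2) have lK: "\<forall>\<^sub>F k in sequentially. lk k \<in> reg_ncone K (p k)"
  proof eventually_elim
    case (elim k)
    have "g (xbar + t k *\<^sub>R uk k) - yk k = g xbar + t k *\<^sub>R p k" using elim by (simp add: p_def e_def)
    then have "lk k \<in> reg_ncone D (g xbar + t k *\<^sub>R p k)" using l[of k] by simp
    then show ?case
      using arr_near_reg_ncone_tcone[OF closedD inD near, of "t k *\<^sub>R p k"]
        arr_cone_reg_ncone_scaleR[OF K, of "t k" "p k"] elim by blast
  qed
  then have "\<forall>\<^sub>F k in sequentially. p k \<in> K" by eventually_elim (simp add: reg_ncone_def)
  then show Au: "A u \<in> K" using plim by (rule Lim_in_closed_set[OF clK _ trivial_limit_sequentially])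
  obtain r' where near': "arr_near F K (A u) r'" using arr_cone_imp_near[OF K] .
  have T: "arr_cone F T" using near' by (rule arr_cone_tcone[OF clK Au])
  then show "\<exists>F. arr_cone F T" by blast
  have "(\<lambda>k. norm (p k - A u)) \<longlonglongrightarrow> 0" using plim by (simp add: LIM_zero tendsto_norm_zero)
  then have "\<forall>\<^sub>F k in sequentially. norm (p k - A u) < r'"
    using near' by (intro order_tendstoD(2)) (auto simp: arr_near_def)
  with t(2) lK
  show "\<forall>\<^sub>F k in sequentially. lk k \<in> reg_ncone T
       ((1 / (t k)\<^sup>2) *\<^sub>R (g (xbar + t k *\<^sub>R uk k) - g xbar - yk k - t k *\<^sub>R A u))"
  proof eventually_elim
    case (elim k)
    have "lk k \<in> reg_ncone T (p k - A u)"
      using arr_near_reg_ncone_tcone[OF clK Au near', of "p k - A u"] elim by simp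
    then have "lk k \<in> reg_ncone T ((1 / t k) *\<^sub>R (p k - A u))"
      using arr_cone_reg_ncone_scaleR[OF T, of "1 / t k" "p k - A u"] elim by simp
    moreover have "(1 / t k) *\<^sub>R (p k - A u)
        = (1 / (t k)\<^sup>2) *\<^sub>R (g (xbar + t k *\<^sub>R uk k) - g xbar - yk k - t k *\<^sub>R A u)"
      using elim by (simp add: p_def e_def scaleR_diff_right power2_eq_square)
    ultimately show ?case by simp
  qed
qed

text \<open>Write \<open>g'\<close> at the moving point as
  \<open>g' xbar + t k *\<^sub>R Q k\<close> with \<open>Q\<close> tending to \<open>g2 u\<close>;
  the extra \<open>t k\<close> combines with the multiplier into the sequence converging to
  \<open>y\<close>.\<close>

lemma adjoint_expansion_tendsto:
  assumes t: "t \<longlonglongrightarrow> 0" "\<forall>\<^sub>F k in sequentially. 0 < t k" and uk: "uk \<longlonglongrightarrow> u"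
    and X: "(\<lambda>k. c k *\<^sub>R adjoint (blinfun_apply (g' (xbar + t k *\<^sub>R uk k))) (lk k)) \<longlonglongrightarrow> X"
    and y: "(\<lambda>k. t k *\<^sub>R (c k *\<^sub>R lk k)) \<longlonglongrightarrow> y"
  shows "(\<lambda>k. adjoint A (c k *\<^sub>R lk k)) \<longlonglongrightarrow> X - lag_hess g2 y u" "adjoint A y = 0"
proof -
  define Q where "Q k = (1 / t k) *\<^sub>R (g' (xbar + t k *\<^sub>R uk k) - g' xbar)" for k
  have Q: "Q \<longlonglongrightarrow> g2 u" unfolding Q_def by (rule has_derivative_quotient_tendsto[OF d2g t uk])
  have "(\<lambda>k. c k *\<^sub>R adjoint (blinfun_apply (g' (xbar + t k *\<^sub>R uk k))) (lk k)
      - adjoint (blinfun_apply (Q k)) (t k *\<^sub>R (c k *\<^sub>R lk k))) \<longlonglongrightarrow> X - lag_hess g2 y u"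
    unfolding lag_hess_eq_adjoint by (intro tendsto_diff X tendsto_adjoint_blinfun Q y)
  moreover have "\<forall>\<^sub>F k in sequentially. c k *\<^sub>R adjoint (blinfun_apply (g' (xbar + t k *\<^sub>R uk k))) (lk k)
      - adjoint (blinfun_apply (Q k)) (t k *\<^sub>R (c k *\<^sub>R lk k)) = adjoint A (c k *\<^sub>R lk k)"
    using t(2)
  proof eventually_elim
    case (elim k)
    have "g' (xbar + t k *\<^sub>R uk k) = g' xbar + t k *\<^sub>R Q k" using elim by (simp add: Q_def)
    then have "adjoint (blinfun_apply (g' (xbar + t k *\<^sub>R uk k))) (lk k)
        = adjoint A (lk k) + t k *\<^sub>R adjoint (blinfun_apply (Q k)) (lk k)"
      by (simp add: adjoint_blinfun_add_left adjoint_blinfun_scaleR_left)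
    then show ?case
      by (simp add: linear_scale[OF linear_adjoint_blinfun] scaleR_add_right mult.commute)
  qed
  ultimately show *: "(\<lambda>k. adjoint A (c k *\<^sub>R lk k)) \<longlonglongrightarrow> X - lag_hess g2 y u"
    by (rule Lim_transform_eventually)
  \<comment> \<open>Multiplying a convergent sequence by \<open>t k\<close> gives limit 0, which
    puts \<open>y\<close> into the kernel.\<close>
  have "(\<lambda>k. t k *\<^sub>R adjoint A (c k *\<^sub>R lk k)) \<longlonglongrightarrow> 0 *\<^sub>R (X - lag_hess g2 y u)"
    by (intro tendsto_scaleR t *)
  moreover have "(\<lambda>k. adjoint A (t k *\<^sub>R (c k *\<^sub>R lk k))) \<longlonglongrightarrow> adjoint A y"
    by (intro tendsto_adjoint_blinfun tendsto_const y)
  ultimately have "adjoint A y = 0 *\<^sub>R (X - lag_hess g2 y u)"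
    unfolding linear_scale[OF linear_adjoint_blinfun] by (rule LIMSEQ_unique[rotated])
  then show "adjoint A y = 0" by simp
qed

text \<open>The scaling \<open>c\<close> is \<open>1\<close> when \<open>t k *\<^sub>R lk k\<close> stays bounded, and otherwise normalises \<open>t k *\<^sub>R lk k\<close>.\<close>

lemma scaled_multiplier_limit:
  assumes t: "t \<longlonglongrightarrow> 0" "\<forall>\<^sub>F k in sequentially. 0 < t k" and uk: "uk \<longlonglongrightarrow> u"
    and yk: "(\<lambda>k. (1 / t k) *\<^sub>R yk k) \<longlonglongrightarrow> 0"
    and l: "\<And>k. lk k \<in> reg_ncone D (g (xbar + t k *\<^sub>R uk k) - yk k)"
    and c: "\<forall>\<^sub>F k in sequentially. 0 < c k"
    and X: "(\<lambda>k. c k *\<^sub>R adjoint (blinfun_apply (g' (xbar + t k *\<^sub>R uk k))) (lk k)) \<longlonglongrightarrow> X"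
    and y: "(\<lambda>k. t k *\<^sub>R (c k *\<^sub>R lk k)) \<longlonglongrightarrow> y"
  shows "\<exists>z \<in> lim_ncone K (A u). X = lag_hess g2 y u + adjoint A z"
    and "(\<lambda>k. (1 / (t k)\<^sup>2) *\<^sub>R yk k) \<longlonglongrightarrow> v \<Longrightarrow>
      \<exists>z s. X = lag_hess g2 y u + adjoint A z \<and> adjoint A y = 0 \<and>
        y \<in> lim_ncone T (A s + (1/2) *\<^sub>R g2 u u - v) \<and>
        (\<forall>b. zcond b T (A s + (1/2) *\<^sub>R g2 u u - v) y z)"
proof -
  define q where "q k = (1 / (t k)\<^sup>2) *\<^sub>R (g (xbar + t k *\<^sub>R uk k) - g xbar - yk k - t k *\<^sub>R A u)" for k
  obtain F where T: "arr_cone F T" using eventually_reg_ncone_T(2)[OF t uk yk l] by blast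
  have lin: "linear A" by (simp add: blinfun.bounded_linear_right bounded_linear.linear)
  note ad = linear_adjoint_blinfun[of "g' xbar"]
  have \<mu>: "\<forall>\<^sub>F k in sequentially. c k *\<^sub>R lk k \<in> reg_ncone T (q k)"
    using eventually_reg_ncone_T(3)[OF t uk yk l] c
  proof eventually_elim
    case (elim k)
    then have lT: "lk k \<in> reg_ncone T (q k)" by (simp add: q_def)
    then have "q k \<in> T" by (simp add: reg_ncone_def)
    \<comment> \<open>The description by homogeneous inequalities shows that scaling by
      \<open>c k\<close> keeps the multiplier normal.\<close>
    then obtain V where "finite V" "reg_ncone T (q k) = {v. \<forall>w\<in>V. w \<bullet> v \<le> 0}"
      by (rule arr_cone_reg_ncone_finitely_constrained[OF T])
    then show ?case using lT elim by (simp add: mult_nonneg_nonpos)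
  qed
  note exp = adjoint_expansion_tendsto[OF t uk X y]
  show "\<exists>z \<in> lim_ncone K (A u). X = lag_hess g2 y u + adjoint A z"
  proof -
    \<comment> \<open>Taking the identity for \<open>A\<close> and \<open>q\<close> for
      \<open>s\<close> meets the convergence requirement trivially; no limit of
      \<open>yk k / (t k)\<^sup>2\<close> is available here, but normality of \<open>z\<close> at 0
      is still obtained.\<close>
    have "(\<lambda>k. q k - id (q k)) \<longlonglongrightarrow> 0" by simp
    then obtain z where "adjoint A z = X - lag_hess g2 y u" "z \<in> lim_ncone T 0"
      using arr_cone_normal_limit[OF T linear_id ad \<mu> _ exp(1) t(2) y] by blast
    then show ?thesis
      using lim_ncone_T_subset[OF eventually_reg_ncone_T(1)[OF t uk yk l]] by (intro bexI[of _ z]) auto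
  qed
  assume v: "(\<lambda>k. (1 / (t k)\<^sup>2) *\<^sub>R yk k) \<longlonglongrightarrow> v"
  have "(\<lambda>k. (1 / (t k)\<^sup>2) *\<^sub>R (g (xbar + t k *\<^sub>R uk k) - g xbar - t k *\<^sub>R A (uk k)) - (1 / (t k)\<^sup>2) *\<^sub>R yk k)
      \<longlonglongrightarrow> (1/2) *\<^sub>R g2 u u - v"
    by (intro tendsto_diff second_order_quotient_tendsto[OF dg d2g t uk] v)
  moreover have "\<forall>\<^sub>F k in sequentially.
      (1 / (t k)\<^sup>2) *\<^sub>R (g (xbar + t k *\<^sub>R uk k) - g xbar - t k *\<^sub>R A (uk k)) - (1 / (t k)\<^sup>2) *\<^sub>R yk k
      = q k - A ((1 / t k) *\<^sub>R (uk k - u))"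
    using t(2)
    by eventually_elim
      (simp add: q_def blinfun.scaleR_right blinfun.diff_right scaleR_diff_right power2_eq_square)
  \<comment> \<open>The quotients \<open>(uk k - u) / t k\<close> play the role of \<open>s\<close>;
    they may be unbounded.\<close>
  ultimately have "(\<lambda>k. q k - A ((1 / t k) *\<^sub>R (uk k - u))) \<longlonglongrightarrow> (1/2) *\<^sub>R g2 u u - v"
    by (rule Lim_transform_eventually)
  then obtain z s where z: "adjoint A z = X - lag_hess g2 y u"
    "y \<in> lim_ncone T (A s + ((1/2) *\<^sub>R g2 u u - v))" "\<forall>b. zcond b T (A s + ((1/2) *\<^sub>R g2 u u - v)) y z" "z \<in> lim_ncone T 0"
    by (rule arr_cone_normal_limit[OF T lin ad \<mu> _ exp(1) t(2) y])
  show "\<exists>z s. X = lag_hess g2 y u + adjoint A z \<and> adjoint A y = 0 \<and>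
      y \<in> lim_ncone T (A s + (1/2) *\<^sub>R g2 u u - v) \<and>
      (\<forall>b. zcond b T (A s + (1/2) *\<^sub>R g2 u u - v) y z)"
    using z exp(2) by (intro exI[of _ z] exI[of _ s]) (simp add: add_diff_eq)
qed

text \<open>The trichotomy on \<open>t k *\<^sub>R lk k\<close>. \<open>H1\<close> is required only
  for \<open>z\<close> satisfying both variants, and the conclusion supplies both, so every
  combination of variants is covered.\<close>

lemma asymptotic_multiplier_alternative:
  assumes unit: "norm u = 1"
    and H1: "\<And>s y z. \<lbrakk>adjoint A y = 0; lag_hess g2 y u + adjoint A z = 0;
        y \<in> lim_ncone T (A s + (1/2) *\<^sub>R g2 u u); \<And>b. zcond b T (A s + (1/2) *\<^sub>R g2 u u) y z\<rbrakk> \<Longrightarrow> y = 0"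
    and cod: "\<And>k. xsk k \<in> reg_coderiv (phi_graph g D) (xk k) (yk k) (lk k)"
    and y0: "\<And>k. yk k \<noteq> 0"
    and xk: "xk \<longlonglongrightarrow> xbar" and xsk: "xsk \<longlonglongrightarrow> xs"
    and ulim: "(\<lambda>k. (1 / norm (xk k - xbar)) *\<^sub>R (xk k - xbar)) \<longlonglongrightarrow> u"
    and ylim: "(\<lambda>k. (1 / norm (xk k - xbar)) *\<^sub>R yk k) \<longlonglongrightarrow> 0"
    and ys: "(\<lambda>k. (norm (yk k) / norm (xk k - xbar)) *\<^sub>R lk k) \<longlonglongrightarrow> ys"
    and linf: "filterlim (\<lambda>k. norm (lk k)) at_top sequentially"
    and par: "(\<lambda>k. (1 / norm (yk k)) *\<^sub>R yk k - (1 / norm (lk k)) *\<^sub>R lk k) \<longlonglongrightarrow> 0"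
  shows "(\<exists>l \<in> lim_ncone K (A u). xs = adjoint A l) \<or>
    (\<exists>s y z \<alpha>. 0 \<le> \<alpha> \<and> xs = lag_hess g2 y u + adjoint A z \<and> adjoint A y = 0 \<and>
      y \<in> lim_ncone T (A s + (1/2) *\<^sub>R g2 u u - \<alpha> *\<^sub>R y) \<and>
      (\<forall>b. zcond b T (A s + (1/2) *\<^sub>R g2 u u - \<alpha> *\<^sub>R y) y z))"
proof -
  define t where "t k = norm (xk k - xbar)" for k
  define uk where "uk k = (1 / t k) *\<^sub>R (xk k - xbar)" for k
  have xk_eq: "xk k = xbar + t k *\<^sub>R uk k" for k by (cases "xk k = xbar") (auto simp: uk_def t_def)
  have tlim: "t \<longlonglongrightarrow> 0" unfolding t_def using xk by (simp add: LIM_zero tendsto_norm_zero)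
  have uk: "uk \<longlonglongrightarrow> u" using ulim unfolding uk_def t_def .
  have tpos: "\<forall>\<^sub>F k in sequentially. 0 < t k"
  proof -
    \<comment> \<open>The norms tend to 1, whereas \<open>t k = 0\<close> would make
      \<open>uk k\<close> zero.\<close>
    have "\<forall>\<^sub>F k in sequentially. 0 < norm (uk k)"
      using unit by (intro order_tendstoD(1)[OF tendsto_norm[OF uk]]) simp
    then show ?thesis by eventually_elim (auto simp: uk_def t_def)
  qed
  have lpos: "\<forall>\<^sub>F k in sequentially. 0 < norm (lk k)"
    using linf unfolding filterlim_at_top_dense by blast
  have lD: "lk k \<in> reg_ncone D (g (xbar + t k *\<^sub>R uk k) - yk k)"
    and xs_eq: "xsk k = adjoint (blinfun_apply (g' (xbar + t k *\<^sub>R uk k))) (lk k)" for k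
    using reg_ncone_phi_graph_imp[OF dg, of "xsk k" "lk k" D "xk k" "yk k"] cod[of k] xk_eq[of k]
    by (auto simp: reg_coderiv_def)
  have yk: "(\<lambda>k. (1 / t k) *\<^sub>R yk k) \<longlonglongrightarrow> 0" using ylim by (simp add: t_def)
  define m where "m k = norm ((norm (yk k) / t k) *\<^sub>R lk k)" for k
  have m: "m \<longlonglongrightarrow> norm ys" unfolding m_def t_def by (intro tendsto_norm ys)
  define n where "n k = t k * norm (lk k)" for k
  \<comment> \<open>This trades the unknown size of \<open>yk k\<close> at second order for
    \<open>m\<close>, which converges, and \<open>n\<close>, the size of
    \<open>t k *\<^sub>R lk k\<close>.\<close>
  have ynorm: "\<forall>\<^sub>F k in sequentially. norm (yk k) / (t k)\<^sup>2 = m k / n k"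
    using tpos lpos by eventually_elim (simp add: m_def n_def power2_eq_square)
  show ?thesis
  proof (cases "filterlim n at_top sequentially")
    \<comment> \<open>Here \<open>c = 1 / n\<close> normalises the multipliers. It sends
      \<open>xsk\<close> to 0 and, through \<open>ynorm\<close>, also
      \<open>yk k / (t k)\<^sup>2\<close>, so a unit vector \<open>y\<close> contradicts
      \<open>H1\<close> with \<open>v = 0\<close>.\<close>
    case True
    have "bounded (range (\<lambda>k. (1 / norm (lk k)) *\<^sub>R lk k))"
      by (rule boundedI[of _ 1]) auto
    then obtain y h where h: "strict_mono (h :: nat \<Rightarrow> nat)" "((\<lambda>k. (1 / norm (lk k)) *\<^sub>R lk k) \<circ> h) \<longlonglongrightarrow> y"
      using bounded_imp_convergent_subsequence by blast
    note ev = eventually_subseq[OF h(1)] and sub = LIMSEQ_subseq_LIMSEQ[OF _ h(1), unfolded o_def]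
    have npos: "\<forall>\<^sub>F k in sequentially. 0 < n k" using True unfolding filterlim_at_top_dense by blast
    have ninv: "(\<lambda>k. 1 / n k) \<longlonglongrightarrow> 0"
      using tendsto_divide_0[OF tendsto_const filterlim_at_top_imp_at_infinity[OF True]] .
    have ny: "norm y = 1"
    proof (rule LIMSEQ_unique)
      show "(\<lambda>k. norm ((1 / norm (lk (h k))) *\<^sub>R lk (h k))) \<longlonglongrightarrow> norm y"
        using tendsto_norm[OF h(2)] by (simp add: o_def)
      show "(\<lambda>k. norm ((1 / norm (lk (h k))) *\<^sub>R lk (h k))) \<longlonglongrightarrow> 1"
        by (rule tendsto_eventually) (use ev[OF lpos] in \<open>eventually_elim, simp\<close>)
    qed
    have "(\<lambda>k. (1 / n k) *\<^sub>R xsk k) \<longlonglongrightarrow> 0 *\<^sub>R xs" by (intro tendsto_scaleR ninv xsk)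
    then have X: "(\<lambda>k. (1 / n (h k)) *\<^sub>R adjoint (blinfun_apply (g' (xbar + t (h k) *\<^sub>R uk (h k)))) (lk (h k))) \<longlonglongrightarrow> 0"
      using sub[of "\<lambda>k. (1 / n k) *\<^sub>R xsk k"] by (simp add: xs_eq)
    have Y: "(\<lambda>k. t (h k) *\<^sub>R ((1 / n (h k)) *\<^sub>R lk (h k))) \<longlonglongrightarrow> y"
    proof (rule Lim_transform_eventually[OF h(2)])
      show "\<forall>\<^sub>F k in sequentially. ((\<lambda>k. (1 / norm (lk k)) *\<^sub>R lk k) \<circ> h) k = t (h k) *\<^sub>R ((1 / n (h k)) *\<^sub>R lk (h k))"
        using ev[OF tpos] by eventually_elim (simp add: n_def)
    qed
    have "(\<lambda>k. m k * (1 / n k)) \<longlonglongrightarrow> norm ys * 0" by (intro tendsto_mult m ninv)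
    then have "(\<lambda>k. m k / n k) \<longlonglongrightarrow> 0" by simp
    then have "(\<lambda>k. norm (yk k) / (t k)\<^sup>2) \<longlonglongrightarrow> 0"
      by (rule Lim_transform_eventually) (use ynorm in \<open>eventually_elim, simp\<close>)
    then have "(\<lambda>k. (1 / (t k)\<^sup>2) *\<^sub>R yk k) \<longlonglongrightarrow> 0"
      by (intro tendsto_norm_zero_cancel[of "\<lambda>k. (1 / (t k)\<^sup>2) *\<^sub>R yk k"]) simp
    then have V: "(\<lambda>k. (1 / (t (h k))\<^sup>2) *\<^sub>R yk (h k)) \<longlonglongrightarrow> 0" by (rule sub)
    have cpos: "\<forall>\<^sub>F k in sequentially. 0 < 1 / n (h k)" using ev[OF npos] by eventually_elim simp
    obtain z s where "0 = lag_hess g2 y u + adjoint A z" "adjoint A y = 0"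
        "y \<in> lim_ncone T (A s + (1/2) *\<^sub>R g2 u u - 0)" "\<And>b. zcond b T (A s + (1/2) *\<^sub>R g2 u u - 0) y z"
      using scaled_multiplier_limit(2)[OF sub[OF tlim] ev[OF tpos] sub[OF uk] sub[OF yk] lD cpos X Y V] by blast
    then have "y = 0" using H1[of y z s] by simp
    then show ?thesis using ny by simp
  next
    case False
    \<comment> \<open>Failure of divergence leaves \<open>n\<close> below some \<open>Z\<close>
      infinitely often, giving a bounded, hence convergent, subsequence of
      \<open>t k *\<^sub>R lk k\<close>.\<close>
    then obtain Z where "\<not> (\<forall>\<^sub>F k in sequentially. Z \<le> n k)" unfolding filterlim_at_top by blast
    then have "infinite {k. n k < Z}"
      by (simp add: not_eventually not_le frequently_cofinite[symmetric] cofinite_eq_sequentially)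
    then obtain h1 :: "nat \<Rightarrow> nat" where h1: "strict_mono h1" "\<And>k. n (h1 k) < Z"
      using infinite_enumerate by blast
    have "bounded (range (\<lambda>k. t (h1 k) *\<^sub>R lk (h1 k)))"
      by (rule boundedI[of _ Z]) (use h1(2) in \<open>auto simp: n_def t_def intro: less_imp_le\<close>)
    then obtain y h2 where h2: "strict_mono (h2 :: nat \<Rightarrow> nat)" "((\<lambda>k. t (h1 k) *\<^sub>R lk (h1 k)) \<circ> h2) \<longlonglongrightarrow> y"
      using bounded_imp_convergent_subsequence by blast
    define h where "h = h1 \<circ> h2"
    have h: "strict_mono h" unfolding h_def using h1(1) h2(1) by (rule strict_mono_o)
    note ev = eventually_subseq[OF h] and sub = LIMSEQ_subseq_LIMSEQ[OF _ h, unfolded o_def]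
    have y: "(\<lambda>k. t (h k) *\<^sub>R lk (h k)) \<longlonglongrightarrow> y" using h2(2) by (simp add: h_def o_def)
    then have Y: "(\<lambda>k. t (h k) *\<^sub>R (1 *\<^sub>R lk (h k))) \<longlonglongrightarrow> y" by simp
    have X: "(\<lambda>k. 1 *\<^sub>R adjoint (blinfun_apply (g' (xbar + t (h k) *\<^sub>R uk (h k)))) (lk (h k))) \<longlonglongrightarrow> xs"
      using sub[OF xsk] by (simp add: xs_eq)
    have cpos: "\<forall>\<^sub>F k in sequentially. (0::real) < 1" by simp
    note lims = sub[OF tlim] ev[OF tpos] sub[OF uk] sub[OF yk] lD cpos X Y
    show ?thesis
    proof (cases "y = 0")
      \<comment> \<open>With \<open>y = 0\<close> the Hessian term vanishes, and \<open>z\<close>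
        itself is the multiplier in \<open>lim_ncone K (A u)\<close>.\<close>
      case True
      then have "lag_hess g2 y u = 0" by (simp add: lag_hess_def)
      then show ?thesis using scaled_multiplier_limit(1)[OF lims] by simp
    next
      case False
      \<comment> \<open>\<open>yk k / (t k)\<^sup>2\<close> has length tending to
        \<open>norm ys / norm y\<close> and, by \<open>par\<close>, the same limiting direction
        \<open>y / norm y\<close> as \<open>lk k\<close>; the product is
        \<open>\<alpha> *\<^sub>R y\<close>.\<close>
      define \<alpha> where "\<alpha> = norm ys / (norm y)\<^sup>2"
      have nlim: "(\<lambda>k. n (h k)) \<longlonglongrightarrow> norm y"
        using tendsto_norm[OF y] by (simp add: n_def t_def)
      have "(\<lambda>k. m (h k) / n (h k)) \<longlonglongrightarrow> norm ys / norm y"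
        using False by (intro tendsto_divide sub[OF m] nlim) simp
      then have q: "(\<lambda>k. norm (yk (h k)) / (t (h k))\<^sup>2) \<longlonglongrightarrow> norm ys / norm y"
        by (rule Lim_transform_eventually) (use ev[OF ynorm] in \<open>eventually_elim, simp\<close>)
      have "(\<lambda>k. (1 / n (h k)) *\<^sub>R (t (h k) *\<^sub>R lk (h k))) \<longlonglongrightarrow> (1 / norm y) *\<^sub>R y"
        using False by (intro tendsto_scaleR tendsto_divide tendsto_const nlim y) simp
      then have "(\<lambda>k. (1 / norm (lk (h k))) *\<^sub>R lk (h k)) \<longlonglongrightarrow> (1 / norm y) *\<^sub>R y"
        by (rule Lim_transform_eventually) (use ev[OF tpos] in \<open>eventually_elim, simp add: n_def\<close>)
      then have "(\<lambda>k. ((1 / norm (yk (h k))) *\<^sub>R yk (h k) - (1 / norm (lk (h k))) *\<^sub>R lk (h k))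
          + (1 / norm (lk (h k))) *\<^sub>R lk (h k)) \<longlonglongrightarrow> 0 + (1 / norm y) *\<^sub>R y"
        by (intro tendsto_add sub[OF par])
      then have "(\<lambda>k. (1 / norm (yk (h k))) *\<^sub>R yk (h k)) \<longlonglongrightarrow> (1 / norm y) *\<^sub>R y" by simp
      then have "(\<lambda>k. (norm (yk (h k)) / (t (h k))\<^sup>2) *\<^sub>R ((1 / norm (yk (h k))) *\<^sub>R yk (h k)))
          \<longlonglongrightarrow> (norm ys / norm y) *\<^sub>R ((1 / norm y) *\<^sub>R y)"
        by (rule tendsto_scaleR[OF q])
      then have V: "(\<lambda>k. (1 / (t (h k))\<^sup>2) *\<^sub>R yk (h k)) \<longlonglongrightarrow> \<alpha> *\<^sub>R y"
        using y0 by (simp add: \<alpha>_def power2_eq_square)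
      have "0 \<le> \<alpha>" by (simp add: \<alpha>_def)
      then show ?thesis using scaled_multiplier_limit(2)[OF lims V] by blast
    qed
  qed
qed

end

section \<open>Asymptotic regularity and its strong form\<close>

theorem theorem5p19:
  fixes g :: "'a::euclidean_space \<Rightarrow> real^'m"
    and g' :: "'a \<Rightarrow> 'a \<Rightarrow>\<^sub>L (real^'m)"
    and g'' :: "'a \<Rightarrow> 'a \<Rightarrow>\<^sub>L 'a \<Rightarrow>\<^sub>L (real^'m)"
    and D :: "(real^'m) set"
    and xbar u :: 'a
    and b1 b2 :: bool
  assumes dg: "\<And>x. (g has_derivative blinfun_apply (g' x)) (at x)"
    and d2g: "\<And>x. (g' has_derivative blinfun_apply (g'' x)) (at x)"
    and cont: "continuous_on UNIV g''"
    and closedD: "closed D"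
    and polyD: "locally_polyhedral_at D (g xbar)"
    and ingph: "(xbar, 0) \<in> phi_graph g D"
    and unit: "norm u = 1"
    and H1: "\<And>s y z. adjoint (blinfun_apply (g' xbar)) y = 0
              \<Longrightarrow> lag_hess (g'' xbar) y u + adjoint (blinfun_apply (g' xbar)) z = 0
              \<Longrightarrow> y \<in> lim_ncone (tcone (tcone D (g xbar)) (g' xbar u))
                       (g' xbar s + (1/2) *\<^sub>R (g'' xbar u u) - 0)
              \<Longrightarrow> zcond b1 (tcone (tcone D (g xbar)) (g' xbar u))
                       (g' xbar s + (1/2) *\<^sub>R (g'' xbar u u) - 0) y z
              \<Longrightarrow> y = 0"
  shows "((\<forall>xs s y z (\<alpha>::real).
             0 \<le> \<alpha>
             \<and> xs = lag_hess (g'' xbar) y u + adjoint (blinfun_apply (g' xbar)) z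
             \<and> y \<in> lim_ncone (tcone (tcone D (g xbar)) (g' xbar u))
                     (g' xbar s + (1/2) *\<^sub>R (g'' xbar u u) - \<alpha> *\<^sub>R y)
             \<and> adjoint (blinfun_apply (g' xbar)) y = 0
             \<and> zcond b2 (tcone (tcone D (g xbar)) (g' xbar u))
                     (g' xbar s + (1/2) *\<^sub>R (g'' xbar u u) - \<alpha> *\<^sub>R y) y z
             \<longrightarrow> (\<exists>l \<in> lim_ncone D (g xbar). xs = adjoint (blinfun_apply (g' xbar)) l))
           \<longrightarrow> asym_regular (phi_graph g D) xbar u)
       \<and> ((\<forall>xs s y z (\<alpha>::real).
             0 \<le> \<alpha>
             \<and> xs = lag_hess (g'' xbar) y u + adjoint (blinfun_apply (g' xbar)) z
             \<and> y \<in> lim_ncone (tcone (tcone D (g xbar)) (g' xbar u))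
                     (g' xbar s + (1/2) *\<^sub>R (g'' xbar u u) - \<alpha> *\<^sub>R y)
             \<and> adjoint (blinfun_apply (g' xbar)) y = 0
             \<and> zcond b2 (tcone (tcone D (g xbar)) (g' xbar u))
                     (g' xbar s + (1/2) *\<^sub>R (g'' xbar u u) - \<alpha> *\<^sub>R y) y z
             \<longrightarrow> (\<exists>l \<in> lim_ncone (tcone D (g xbar)) (g' xbar u).
                    xs = adjoint (blinfun_apply (g' xbar)) l))
           \<longrightarrow> strong_asym_regular (phi_graph g D) xbar u)"
proof -
  have inD: "g xbar \<in> D" using ingph by (simp add: phi_graph_def)
  interpret polyhedral_constraint g g' "g'' xbar" D xbar u
    by unfold_locales (rule dg d2g closedD polyD inD)+
  have alt: "(\<exists>l \<in> lim_ncone K (A u). xs = adjoint A l) \<or>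
      (\<exists>s y z \<alpha>. 0 \<le> \<alpha> \<and> xs = lag_hess (g'' xbar) y u + adjoint A z \<and> adjoint A y = 0 \<and>
        y \<in> lim_ncone T (A s + (1/2) *\<^sub>R g'' xbar u u - \<alpha> *\<^sub>R y) \<and>
        (\<forall>b. zcond b T (A s + (1/2) *\<^sub>R g'' xbar u u - \<alpha> *\<^sub>R y) y z))"
    if asm: "(\<forall>k. (xk k, yk k) \<in> phi_graph g D \<and> (xk k, 0) \<notin> phi_graph g D \<and> yk k \<noteq> 0
         \<and> xsk k \<in> reg_coderiv (phi_graph g D) (xk k) (yk k) (lk k))
       \<and> xk \<longlonglongrightarrow> xbar \<and> yk \<longlonglongrightarrow> 0 \<and> xsk \<longlonglongrightarrow> xs
       \<and> (\<lambda>k. (1 / norm (xk k - xbar)) *\<^sub>R (xk k - xbar)) \<longlonglongrightarrow> u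
       \<and> (\<lambda>k. (1 / norm (xk k - xbar)) *\<^sub>R yk k) \<longlonglongrightarrow> 0
       \<and> (\<lambda>k. (norm (yk k) / norm (xk k - xbar)) *\<^sub>R lk k) \<longlonglongrightarrow> ys
       \<and> filterlim (\<lambda>k. norm (lk k)) at_top sequentially
       \<and> (\<lambda>k. (1 / norm (yk k)) *\<^sub>R yk k - (1 / norm (lk k)) *\<^sub>R lk k) \<longlonglongrightarrow> 0"
    for xk yk xsk lk xs ys
  proof (rule asymptotic_multiplier_alternative
      [where xk = xk and yk = yk and xsk = xsk and lk = lk and ys = ys, OF unit])
    fix s y z
    assume "adjoint A y = 0" "lag_hess (g'' xbar) y u + adjoint A z = 0"
      "y \<in> lim_ncone T (A s + (1/2) *\<^sub>R g'' xbar u u)" "\<And>b. zcond b T (A s + (1/2) *\<^sub>R g'' xbar u u) y z"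
    then show "y = 0" using H1[of y z s] by simp
  qed (use asm in blast)+
  show ?thesis
    unfolding asym_regular_def strong_asym_regular_def asym_reg_cond_def
  proof (intro conjI impI allI, goal_cases)
    case (1 xk yk xsk lk xs ys)
    \<comment> \<open>The first alternative already gives a normal to \<open>K\<close> at
      \<open>A u\<close>, which is also a limiting normal to \<open>D\<close>; the second is settled
      by the hypothesis at variant \<open>b2\<close>.\<close>
    have "\<exists>l \<in> lim_ncone D (g xbar). xs = adjoint A l"
      using alt[OF 1(2)] lim_ncone_K_subset 1(1) by blast
    then show ?case using lim_coderivI by blast
  next
    case (2 xk yk xsk lk xs ys)
    have "\<exists>l \<in> lim_ncone K (A u). xs = adjoint A l"
      using alt[OF 2(2)] 2(1) by blast
    then show ?case using dir_coderivI by blast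
  qed
qed

end
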